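(* Consider the downlink model described in the context, with Nakagami parameter $m\in\{1,2,3,\dots\}$, path-loss exponent $\alpha>0$, SIR threshold $\beta_{\rm th}>0$, and let $$f_{r_0}(r)=2\pi\lambda r\, e^{-\lambda\pi (r^2-h_{\rm d}^2)},\qquad r\ge h_{\rm d},$$ be the density of the 3D distance $r_0$ from the typical UAV-UE to its nearest TBS. Then the coverage probability $P^{\rm cov}=\mathbb{P}(\gamma\ge\beta_{\rm th})$ is given as follows. If $\theta_1\ge 0^\circ$: $$P^{\rm cov}=\sum_{k=0}^{m-1}\frac{(-1)^k}{k!}(m\beta_{\rm th})^k\int_{h_{\rm d}}^{\infty}\frac{r^{k\alpha}}{(P_{\rm T}A_V^L)^k}\left[\frac{\partial^k\mathcal{L}_I(s;r)}{\partial s^k}\right]_{s=\frac{m\beta_{\rm th}r^\alpha}{P_{\rm T}A_V^L}} f_{r_0}(r)\,dr .$$ If $\theta_1\le 0^\circ$, writing $\Gamma_V(r)=10^{-1.2\left(\frac{-\sin^{-1}(h_{\rm d}/r)-\theta_{\rm t}}{\theta_{\rm 3dB}}\right)^2}$: $$P^{\rm cov}=\sum_{k=0}^{m-1}\frac{(-1)^k}{k!}(m\beta_{\rm th})^k\int_{h_{\rm d}}^{r_1}\frac{r^{k\alpha}}{(P_{\rm T}A_V^L)^k}\left[\frac{\partial^k\mathcal{L}_I(s;r)}{\partial s^k}\right]_{s=\frac{m\beta_{\rm th}r^\alpha}{P_{\rm T}A_V^L}} f_{r_0}(r)\,dr$$ $$\qquad+\sum_{k=0}^{m-1}\frac{(-1)^k}{k!}(m\beta_{\rm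 th})^k\int_{r_1}^{\infty}\frac{r^{k\alpha}}{(P_{\rm T}\Gamma_V(r))^k}\left[\frac{\partial^k\mathcal{L}_I(s;r)}{\partial s^k}\right]_{s=\frac{m\beta_{\rm th}r^\alpha}{P_{\rm T}\Gamma_V(r)}} f_{r_0}(r)\,dr .$$
   Context: Network: terrestrial base stations (TBSs) have horizontal positions forming a homogeneous Poisson point process $\Phi$ in $\mathbb{R}^2$ of intensity $\lambda>0$, all at height $h_{\rm BS}$ with common transmit power $P_{\rm T}>0$. The typical UAV user (UAV-UE) hovers at height $h_{\rm UAV}>h_{\rm BS}$ above the origin; set $h_{\rm d}=h_{\rm UAV}-h_{\rm BS}>0$. For a TBS $x_i\in\Phi$, $r_i=\sqrt{\|x_i\|^2+h_{\rm d}^2}$ is its 3D distance to the UAV-UE. Angles (elevation, tilt, beamwidth) are all measured in the same unit (degrees). Antenna gain: parameters are the down-tilt $\theta_{\rm t}$, the 3dB beamwidth $\theta_{\rm 3dB}>0$, and the sidelobe attenuation $A_V>0$ (dB). Let $\theta_1=\theta_{\rm t}-\sqrt{A_V/12}\,\theta_{\rm 3dB}$, $A_V^L=10^{-A_V/10}$, and, when $\theta_1<0^\circ$, $r_1=h_{\rm d}/\sin(-\theta_1)$. The (linear) vertical antenna gain of a TBS at 3D distance $r\ge h_{\rm d}$ from the UAV-UE is: if $\theta_1\ge0^\circ$, $G(r)=A_V^L$ for all $r$; if $\theta_1\le 0^\circ$, $G(r)=A_V^L$ for $r<r_1$ and $G(r)=10^{-1.2\left(\frac{-\sin^{-1}(h_{\rm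 d}/r)-\theta_{\rm t}}{\theta_{\rm 3dB}}\right)^2}$ for $r\ge r_1$. (This is the 3GPP pattern $-\min[12((\theta-\theta_{\rm t})/\theta_{\rm 3dB})^2,A_V]$ dB evaluated at the elevation angle $\theta=-\sin^{-1}(h_{\rm d}/r)$.) Channel: the power gains $g_i$ are i.i.d. Gamma with shape $m$ and rate $m$ (unit mean), $m$ a positive integer, independent of $\Phi$. The received power from TBS $x_i$ is $P_{\rm T}G(r_i)g_i r_i^{-\alpha}$. The UAV-UE associates with the TBS $x_0^*$ of smallest $r_i$; denote its distance $r_0$ and fading $g_0$. The SIR is $\gamma=P_{\rm T}G(r_0)g_0r_0^{-\alpha}/I$ with $I=\sum_{x_i\in\Phi\setminus\{x_0^*\}}P_{\rm T}G(r_i)g_ir_i^{-\alpha}$ (noise neglected). Laplace transform of interference conditioned on the serving distance $r_0=r$: $$\mathcal{L}_I(s;r)=\exp\!\left(-2\pi\lambda\int_r^\infty\left(1-\left(\frac{m}{m+sP_{\rm T}G(t)t^{-\alpha}}\right)^m\right)t\,dt\right),$$ and $\partial^k/\partial s^k$ denotes the $k$-th derivative in $s$ with $r$ held fixed, evaluated at the indicated value of $s$. *)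

theory Defs
  imports "HOL-Probability.Probability"
begin

definition deg2rad :: "real \<Rightarrow> real" where
  "deg2rad x = x * pi / 180"

definition rad2deg :: "real \<Rightarrow> real" where
  "rad2deg x = x * 180 / pi"

definition theta1 :: "real \<Rightarrow> real \<Rightarrow> real \<Rightarrow> real" where
  "theta1 th_t th_3dB A_V = th_t - sqrt (A_V / 12) * th_3dB"

definition AVL :: "real \<Rightarrow> real" where
  "AVL A_V = 10 powr (- A_V / 10)"

definition r1 :: "real \<Rightarrow> real \<Rightarrow> real \<Rightarrow> real \<Rightarrow> real" where
  "r1 h_d th_t th_3dB A_V = h_d / sin (deg2rad (- theta1 th_t th_3dB A_V))"

definition GammaV :: "real \<Rightarrow> real \<Rightarrow> real \<Rightarrow> real \<Rightarrow> real" where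
  "GammaV h_d th_t th_3dB r =
     10 powr (- 1.2 * ((- rad2deg (arcsin (h_d / r)) - th_t) / th_3dB)\<^sup>2)"

definition gain :: "real \<Rightarrow> real \<Rightarrow> real \<Rightarrow> real \<Rightarrow> real \<Rightarrow> real" where
  "gain h_d th_t th_3dB A_V r =
     (if theta1 th_t th_3dB A_V \<ge> 0 then AVL A_V
      else if r < r1 h_d th_t th_3dB A_V then AVL A_V
      else GammaV h_d th_t th_3dB r)"

text \<open>L_I(s;r) = exp(-2 pi lambda int_r^oo (1 - (m/(m + s P_T G(t) t^-alpha))^m) t dt).
  The integral is a nonnegative (extended) integral; if it is infinite, exp(-oo) = 0.\<close>
definition LI :: "real \<Rightarrow> real \<Rightarrow> nat \<Rightarrow> real \<Rightarrow> (real \<Rightarrow> real) \<Rightarrow> real \<Rightarrow> real \<Rightarrow> real" where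
  "LI lam P_T m alpha G r s =
     (let J = (\<integral>\<^sup>+ t \<in> {r..}. ennreal
                 ((1 - (real m / (real m + s * P_T * G t * t powr (- alpha))) ^ m) * t) \<partial>lborel)
      in if J = \<infinity> then 0 else exp (- 2 * pi * lam * enn2real J))"

definition f_r0 :: "real \<Rightarrow> real \<Rightarrow> real \<Rightarrow> real" where
  "f_r0 lam h_d r =
     (if r \<ge> h_d then 2 * pi * lam * r * exp (- lam * pi * (r\<^sup>2 - h_d\<^sup>2)) else 0)"

text \<open>The TBS horizontal positions are given by an enumeration X n (n :: nat) of the points
  of Phi, with i.i.d. Gamma(m,m) fading marks g n independent of the positions.\<close>

definition num_in :: "(nat \<Rightarrow> 'a \<Rightarrow> real \<times> real) \<Rightarrow> (real \<times> real) set \<Rightarrow> 'a \<Rightarrow> nat" where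
  "num_in X B \<omega> = card {n. X n \<omega> \<in> B}"

definition is_PPP :: "'a measure \<Rightarrow> real \<Rightarrow> (nat \<Rightarrow> 'a \<Rightarrow> real \<times> real) \<Rightarrow> bool" where
  "is_PPP M lam X \<longleftrightarrow>
     (\<forall>n. X n \<in> borel_measurable M) \<and>
     (\<forall>B \<in> sets borel. bounded B \<longrightarrow>
        (AE \<omega> in M. finite {n. X n \<omega> \<in> B}) \<and>
        (\<forall>k::nat. measure M {\<omega> \<in> space M. num_in X B \<omega> = k}
                  = (lam * measure lborel B) ^ k / fact k * exp (- lam * measure lborel B))) \<and>
     (\<forall>(I :: nat set) (B :: nat \<Rightarrow> (real \<times> real) set).
        (\<forall>i\<in>I. B i \<in> sets borel \<and> bounded (B i)) \<longrightarrow> disjoint_family_on B I \<longrightarrow>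
        prob_space.indep_vars M (\<lambda>_. count_space UNIV) (\<lambda>i. num_in X (B i)) I)"

definition dist3 :: "real \<Rightarrow> (nat \<Rightarrow> 'a \<Rightarrow> real \<times> real) \<Rightarrow> nat \<Rightarrow> 'a \<Rightarrow> real" where
  "dist3 h_d X n \<omega> = sqrt ((norm (X n \<omega>))\<^sup>2 + h_d\<^sup>2)"

definition rx_power :: "real \<Rightarrow> (real \<Rightarrow> real) \<Rightarrow> real \<Rightarrow> real \<Rightarrow> (nat \<Rightarrow> 'a \<Rightarrow> real \<times> real)
                         \<Rightarrow> (nat \<Rightarrow> 'a \<Rightarrow> real) \<Rightarrow> nat \<Rightarrow> 'a \<Rightarrow> real" where
  "rx_power P_T G alpha h_d X g n \<omega> =
     P_T * G (dist3 h_d X n \<omega>) * g n \<omega> * dist3 h_d X n \<omega> powr (- alpha)"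

definition sir :: "real \<Rightarrow> (real \<Rightarrow> real) \<Rightarrow> real \<Rightarrow> real \<Rightarrow> (nat \<Rightarrow> 'a \<Rightarrow> real \<times> real)
                         \<Rightarrow> (nat \<Rightarrow> 'a \<Rightarrow> real) \<Rightarrow> nat \<Rightarrow> 'a \<Rightarrow> ennreal" where
  "sir P_T G alpha h_d X g n0 \<omega> =
     ennreal (rx_power P_T G alpha h_d X g n0 \<omega>) /
     (\<Sum>n. if n = n0 then 0 else ennreal (rx_power P_T G alpha h_d X g n \<omega>))"

definition coverage_prob :: "'a measure \<Rightarrow> real \<Rightarrow> (real \<Rightarrow> real) \<Rightarrow> real \<Rightarrow> real
                         \<Rightarrow> (nat \<Rightarrow> 'a \<Rightarrow> real \<times> real) \<Rightarrow> (nat \<Rightarrow> 'a \<Rightarrow> real) \<Rightarrow> real \<Rightarrow> real" where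
  "coverage_prob M P_T G alpha h_d X g beta =
     measure M {\<omega> \<in> space M. \<exists>n0.
        (\<forall>n. n \<noteq> n0 \<longrightarrow> dist3 h_d X n0 \<omega> < dist3 h_d X n \<omega>) \<and>
        sir P_T G alpha h_d X g n0 \<omega> \<ge> ennreal beta}"

definition cov_term :: "real \<Rightarrow> real \<Rightarrow> nat \<Rightarrow> real \<Rightarrow> (real \<Rightarrow> real) \<Rightarrow> real \<Rightarrow> real
                         \<Rightarrow> nat \<Rightarrow> real \<Rightarrow> real \<Rightarrow> real" where
  "cov_term lam P_T m alpha G h_d beta k Gc r =
     (-1) ^ k / fact k * (real m * beta) ^ k * (r powr (real k * alpha) / (P_T * Gc) ^ k)
     * (deriv ^^ k) (LI lam P_T m alpha G r) (real m * beta * r powr alpha / (P_T * Gc))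
     * f_r0 lam h_d r"

end

theory Submission
  imports Defs "HOL-Computational_Algebra.Polynomial"
begin

text \<open>
  Only the distances of the base stations matter. They form a Poisson process on the half line
  with intensity \<open>2\<pi>\<lambda>t\<close> on \<open>t \<ge> h\<^sub>d\<close>, so write \<open>Z\<^sub>r\<close> for the interference from all stations farther away
  than \<open>r\<close>. Its Laplace transform is \<open>\<L>\<^sub>I(\<cdot>; r)\<close>, by the Laplace functional of the process, and \<open>Z\<^sub>r\<close>
  is decreasing in \<open>r\<close>. On a short interval \<open>(a, b]\<close> the nearest station is, up to an error quadratic in the
  length, the only one there and its interference is \<open>Z\<^sub>b\<close>, which is independent of the points in \<open>[0, b]\<close>;
  summing over a fine partition (monotonicity in \<open>r\<close> controls the Riemann sums) shows that the interference
  given a serving distance \<open>r\<close> has the Laplace transform of \<open>Z\<^sub>r\<close>. Bernstein polynomials in \<open>exp (- I)\<close> upgrade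
  this from exponentials to the function that is needed: conditionally on everything but the serving
  fading gain, coverage has the Erlang tail probability \<open>\<Sum>k<m. (sI)\<^sup>k e\<^sup>-\<^sup>s\<^sup>I / k!\<close> with
  \<open>s = m\<beta> r\<^sup>\<alpha> / (P\<^sub>T G(r))\<close>. Its expectation under \<open>I = Z\<^sub>r\<close> is read off from the derivatives of the
  Laplace transform at \<open>s\<close>. The value \<open>Z\<^sub>r = \<infinity>\<close> (which occurs for \<open>\<alpha> \<le> 2\<close>) is allowed throughout.
\<close>

section \<open>Analytic preliminaries\<close>

definition exp_neg :: "ennreal \<Rightarrow> real" where
  "exp_neg x = (if x = \<infinity> then 0 else exp (- enn2real x))"

lemma exp_neg_nonneg [simp]: "0 \<le> exp_neg x"
  by (simp add: exp_neg_def)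

lemma exp_neg_le_1 [simp]: "exp_neg x \<le> 1"
  by (simp add: exp_neg_def)

lemma exp_neg_0 [simp]: "exp_neg 0 = 1"
  by (simp add: exp_neg_def)

lemma exp_neg_top [simp]: "exp_neg top = 0"
  by (simp add: exp_neg_def)

lemma exp_neg_ennreal: "0 \<le> x \<Longrightarrow> exp_neg (ennreal x) = exp (- x)"
  by (simp add: exp_neg_def)

lemma exp_neg_measurable [measurable]: "exp_neg \<in> borel_measurable borel"
  unfolding exp_neg_def[abs_def] by measurable

lemma exp_neg_add: "exp_neg (x + y) = exp_neg x * exp_neg y"
  by (cases x; cases y) (auto simp: exp_neg_def ennreal_plus[symmetric] exp_add[symmetric] simp del: ennreal_plus)

lemma exp_neg_sum: "finite A \<Longrightarrow> exp_neg (sum f A) = (\<Prod>i\<in>A. exp_neg (f i))"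
  by (induction rule: finite_induct) (auto simp: exp_neg_add)

lemma exp_neg_antimono: "x \<le> y \<Longrightarrow> exp_neg y \<le> exp_neg x"
  by (cases x; cases y) (auto simp: exp_neg_def top_unique)

lemma exp_neg_power: "exp_neg x ^ k = exp_neg (of_nat k * x)"
  by (induction k) (auto simp: exp_neg_add distrib_right)

lemma tendsto_exp_neg:
  assumes "(f \<longlongrightarrow> x) F"
  shows "((\<lambda>n. exp_neg (f n)) \<longlongrightarrow> exp_neg x) F"
proof (cases "x = \<infinity>")
  case False
  then obtain r where r: "x = ennreal r" "0 \<le> r" by (cases x) auto
  have ev: "eventually (\<lambda>n. f n < \<infinity>) F"
    using order_tendstoD(2)[OF assms, of \<infinity>] r by simp
  have "((\<lambda>n. exp (- enn2real (f n))) \<longlongrightarrow> exp (- r)) F"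
    using assms r by (intro tendsto_intros tendsto_enn2real) auto
  moreover have "\<forall>\<^sub>F n in F. exp (- enn2real (f n)) = exp_neg (f n)"
    using ev by eventually_elim (auto simp: exp_neg_def)
  ultimately have "((\<lambda>n. exp_neg (f n)) \<longlongrightarrow> exp (- r)) F"
    by (rule Lim_transform_eventually)
  then show ?thesis
    using r by (simp add: exp_neg_ennreal)
next
  case True
  show ?thesis unfolding True
  proof (rule tendstoI)
    fix e :: real assume e: "0 < e"
    have "eventually (\<lambda>n. ennreal (max 0 (- ln e) + 1) < f n) F"
      using order_tendstoD(1)[OF assms, of "ennreal (max 0 (- ln e) + 1)"] True by simp
    then show "eventually (\<lambda>n. dist (exp_neg (f n)) (exp_neg \<infinity>) < e) F"
    proof eventually_elim
      case (elim n)
      then have "exp_neg (f n) \<le> exp_neg (ennreal (max 0 (- ln e) + 1))"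
        by (intro exp_neg_antimono) auto
      also have "\<dots> = exp (- (max 0 (- ln e) + 1))"
        by (rule exp_neg_ennreal) simp
      also have "\<dots> < exp (ln e)"
        by (subst exp_less_cancel_iff) linarith
      finally show ?case using e by simp
    qed
  qed
qed

lemma tendsto_exp_neg_SUP:
  assumes "incseq f"
  shows "(\<lambda>n. exp_neg (f n)) \<longlonglongrightarrow> exp_neg (SUP n. f n)"
  by (intro tendsto_exp_neg LIMSEQ_SUP assms)

lemma tendsto_exp_neg_suminf:
  fixes f :: "nat \<Rightarrow> ennreal"
  shows "(\<lambda>n. exp_neg (\<Sum>i<n. f i)) \<longlonglongrightarrow> exp_neg (\<Sum>i. f i)"
  by (intro tendsto_exp_neg summable_LIMSEQ summableI)

lemma eq_if_increment_bound:
  fixes f M :: "real \<Rightarrow> real"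
  assumes ab: "a \<le> b"
    and bound: "\<And>x y. a \<le> x \<Longrightarrow> x \<le> y \<Longrightarrow> y \<le> b \<Longrightarrow> \<bar>f y - f x\<bar> \<le> C * (y - x) * (M y - M x)"
  shows "f b = f a"
proof -
  have "\<bar>f b - f a\<bar> \<le> C * (b - a) * (M b - M a) * inverse (real (Suc n))" for n
  proof -
    define N where "N = Suc n"
    define x where "x i = a + (b - a) * real i / real N" for i
    have x0: "x 0 = a" and xN: "x N = b"
      by (simp_all add: x_def N_def)
    have diff: "x (Suc i) - x i = (b - a) * inverse (real N)" for i
      by (simp add: x_def add_divide_distrib ring_distribs inverse_eq_divide)
    have xmono: "x i \<le> x j" if "i \<le> j" for i j
      using that ab by (auto simp: x_def intro!: divide_right_mono mult_left_mono)
    have "\<bar>f b - f a\<bar> = \<bar>\<Sum>i<N. f (x (Suc i)) - f (x i)\<bar>"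
      by (simp add: sum_lessThan_telescope[where f = "\<lambda>i. f (x i)"] x0 xN)
    also have "\<dots> \<le> (\<Sum>i<N. \<bar>f (x (Suc i)) - f (x i)\<bar>)"
      by (rule sum_abs)
    also have "\<dots> \<le> (\<Sum>i<N. C * (b - a) * inverse (real N) * (M (x (Suc i)) - M (x i)))"
    proof (rule sum_mono)
      fix i assume "i \<in> {..<N}"
      then have "a \<le> x i" "x i \<le> x (Suc i)" "x (Suc i) \<le> b"
        using xmono[of 0 i] xmono[of i "Suc i"] xmono[of "Suc i" N] by (auto simp: x0 xN)
      from bound[OF this]
      show "\<bar>f (x (Suc i)) - f (x i)\<bar> \<le> C * (b - a) * inverse (real N) * (M (x (Suc i)) - M (x i))"
        by (simp add: diff mult.assoc)
    qed
    also have "\<dots> = C * (b - a) * inverse (real N) * (M b - M a)"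
      by (simp add: sum_distrib_left[symmetric] sum_lessThan_telescope[where f = "\<lambda>i. M (x i)"] x0 xN)
    finally show ?thesis by (simp add: N_def mult_ac)
  qed
  moreover have "(\<lambda>n. C * (b - a) * (M b - M a) * inverse (real (Suc n))) \<longlonglongrightarrow> C * (b - a) * (M b - M a) * 0"
    by (intro tendsto_intros LIMSEQ_inverse_real_of_nat)
  ultimately have "\<bar>f b - f a\<bar> \<le> 0"
    by (intro LIMSEQ_le_const[where X = "\<lambda>n. C * (b - a) * (M b - M a) * inverse (real (Suc n))"]) auto
  then show ?thesis by simp
qed

lemma measure_eqI_Ioc:
  fixes M N :: "real measure"
  assumes sets: "sets M = sets borel" "sets N = sets borel"
    and fin: "\<And>a b. a \<le> b \<Longrightarrow> emeasure M {a<..b} \<noteq> \<infinity>"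
    and eq: "\<And>a b. a \<le> b \<Longrightarrow> emeasure M {a<..b} = emeasure N {a<..b}"
  shows "M = N"
proof (rule measure_eqI_generator_eq[where \<Omega>=UNIV and E = "range (\<lambda>(a, b). {a <.. b::real})"
      and A = "\<lambda>n. {- real n<..real n}"])
  show "Int_stable (range (\<lambda>(a, b). {a <.. b::real}))"
  proof (rule Int_stableI)
    fix A B assume "A \<in> range (\<lambda>(a, b). {a <.. b::real})" "B \<in> range (\<lambda>(a, b). {a <.. b::real})"
    then obtain a b c d where "A = {a<..b}" "B = {c<..d}" by auto
    then have "A \<inter> B = (\<lambda>(a, b). {a <.. b}) (max a c, min b d)" by auto
    then show "A \<inter> B \<in> range (\<lambda>(a, b). {a <.. b::real})" by blast
  qed
  show "emeasure M X = emeasure N X" if X: "X \<in> range (\<lambda>(a, b). {a <.. b::real})" for X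
  proof -
    obtain a b where "X = {a<..b}" using X by auto
    then show ?thesis using eq[of a b] by (cases "a \<le> b") auto
  qed
  show "(\<Union>i. {- real i<..real i}) = UNIV"
  proof safe
    fix x :: real
    obtain n where "\<bar>x\<bar> < real n" using reals_Archimedean2 by blast
    then show "x \<in> (\<Union>i. {- real i<..real i})" by (intro UN_I[of n]) auto
  qed auto
  show "sets M = sigma_sets UNIV (range (\<lambda>(a, b). {a <.. b::real}))"
    "sets N = sigma_sets UNIV (range (\<lambda>(a, b). {a <.. b::real}))"
    using sets by (simp_all add: borel_sigma_sets_Ioc)
qed (use fin in auto)

lemma (in prob_space) erlang_laplace_transform:
  assumes X: "distributed M lborel X (erlang_density k l)" and l: "0 < l" and w: "0 \<le> w"
  shows "(\<integral>\<^sup>+\<omega>. ennreal (exp (- w * X \<omega>)) \<partial>M) = ennreal ((l / (l + w)) ^ Suc k)"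
proof -
  have lw: "0 < l + w" using l w by simp
  interpret D: prob_space "density lborel (erlang_density k (l + w))"
    by (rule prob_space_erlang_density[OF lw])
  have one: "(\<integral>\<^sup>+x. ennreal (erlang_density k (l + w) x) \<partial>lborel) = 1"
    using D.emeasure_space_1 by (simp add: emeasure_density)
  have "(\<integral>\<^sup>+\<omega>. ennreal (exp (- w * X \<omega>)) \<partial>M)
      = (\<integral>\<^sup>+x. ennreal (erlang_density k l x) * ennreal (exp (- w * x)) \<partial>lborel)"
    by (rule distributed_nn_integral[OF X, symmetric]) simp
  also have "\<dots> = (\<integral>\<^sup>+x. ennreal ((l / (l + w)) ^ Suc k) * ennreal (erlang_density k (l + w) x) \<partial>lborel)"
  proof (rule nn_integral_cong)
    fix x :: real
    have "erlang_density k l x * exp (- w * x) = (l / (l + w)) ^ Suc k * erlang_density k (l + w) x"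
    proof (cases "x < 0")
      case False
      have "exp (- l * x) * exp (- w * x) = exp (- (l + w) * x)"
        by (simp add: exp_add[symmetric] algebra_simps)
      then have "erlang_density k l x * exp (- w * x) = l ^ Suc k * x ^ k * exp (- (l + w) * x) / fact k"
        using False by (simp add: erlang_density_def)
      also have "\<dots> = (l / (l + w)) ^ Suc k * erlang_density k (l + w) x"
        using False lw by (simp add: erlang_density_def power_divide)
      finally show ?thesis .
    qed (simp add: erlang_density_def)
    then show "ennreal (erlang_density k l x) * ennreal (exp (- w * x))
        = ennreal ((l / (l + w)) ^ Suc k) * ennreal (erlang_density k (l + w) x)"
      using l lw by (simp add: ennreal_mult[symmetric] del: power_Suc)
  qed
  also have "\<dots> = ennreal ((l / (l + w)) ^ Suc k)"
    by (simp add: nn_integral_cmult one del: power_Suc)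
  finally show ?thesis .
qed

section \<open>Poisson points on the half line\<close>

definition intensity :: "real \<Rightarrow> real \<Rightarrow> real measure" where
  "intensity lam h = density lborel (\<lambda>t. ennreal (2 * pi * lam * t) * indicator {h..} t)"

definition cum_intensity :: "real \<Rightarrow> real \<Rightarrow> real \<Rightarrow> real" where
  "cum_intensity lam h t = (if t < h then 0 else pi * lam * (t\<^sup>2 - h\<^sup>2))"

lemma sets_intensity [measurable_cong, simp]: "sets (intensity lam h) = sets borel"
  by (simp add: intensity_def)

lemma space_intensity [simp]: "space (intensity lam h) = UNIV"
  by (simp add: intensity_def)

lemma nn_integral_intensity:
  assumes [measurable]: "f \<in> borel_measurable borel"
  shows "(\<integral>\<^sup>+t. f t \<partial>intensity lam h)
       = (\<integral>\<^sup>+t. ennreal (2 * pi * lam * t) * indicator {h..} t * f t \<partial>lborel)"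
  unfolding intensity_def by (subst nn_integral_density) auto

lemma emeasure_intensity_Ioc:
  assumes "0 \<le> lam" "0 < h" "a \<le> b"
  shows "emeasure (intensity lam h) {a<..b} = ennreal (cum_intensity lam h b - cum_intensity lam h a)"
proof (cases "b < h")
  case True
  have "emeasure (intensity lam h) {a<..b}
      = (\<integral>\<^sup>+t. ennreal (2 * pi * lam * t) * indicator {h..} t * indicator {a<..b} t \<partial>lborel)"
    unfolding intensity_def by (subst emeasure_density) auto
  also have "\<dots> = (\<integral>\<^sup>+t. 0 \<partial>(lborel :: real measure))"
    using True by (intro nn_integral_cong) (auto split: split_indicator)
  finally have "emeasure (intensity lam h) {a<..b} = 0" by simp
  then show ?thesis
    using True assms by (simp add: cum_intensity_def)
next
  case False
  define c where "c = max a h"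
  have c: "h \<le> c" "c \<le> b" "0 < c" using False assms by (auto simp: c_def)
  have "emeasure (intensity lam h) {a<..b}
      = (\<integral>\<^sup>+t. ennreal (2 * pi * lam * t) * indicator {c..b} t \<partial>lborel)"
    unfolding intensity_def
  proof (subst emeasure_density)
    show "(\<integral>\<^sup>+ t. ennreal (2 * pi * lam * t) * indicator {h..} t * indicator {a<..b} t \<partial>lborel)
        = (\<integral>\<^sup>+t. ennreal (2 * pi * lam * t) * indicator {c..b} t \<partial>lborel)"
    proof (rule nn_integral_cong_AE)
      show "AE t in lborel. ennreal (2 * pi * lam * t) * indicator {h..} t * indicator {a<..b} t
          = ennreal (2 * pi * lam * t) * indicator {c..b} t"
        using AE_lborel_singleton[of a]
        by eventually_elim (auto simp: c_def split: split_indicator)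
    qed
  qed auto
  also have "\<dots> = ennreal (pi * lam * b\<^sup>2 - pi * lam * c\<^sup>2)"
  proof (rule nn_integral_FTC_Icc[where F = "\<lambda>t. pi * lam * t\<^sup>2"])
    show "((\<lambda>t. pi * lam * t\<^sup>2) has_real_derivative 2 * pi * lam * t) (at t)" for t
      by (auto intro!: derivative_eq_intros)
    show "0 \<le> 2 * pi * lam * t" if "t \<in> {c..b}" for t
      using that assms c by auto
  qed (use c in auto)
  also have "pi * lam * b\<^sup>2 - pi * lam * c\<^sup>2 = cum_intensity lam h b - cum_intensity lam h a"
    using False by (auto simp: cum_intensity_def c_def max_def algebra_simps)
  finally show ?thesis .
qed

lemma emeasure_intensity_bounded:
  assumes "0 \<le> lam" "0 < h" "bounded B"
  shows "emeasure (intensity lam h) B \<noteq> \<infinity>"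
proof -
  obtain c where c: "\<And>x. x \<in> B \<Longrightarrow> \<bar>x\<bar> \<le> c"
    using \<open>bounded B\<close> by (auto simp: bounded_iff)
  have "emeasure (intensity lam h) B \<le> emeasure (intensity lam h) {- \<bar>c\<bar> - 1<..\<bar>c\<bar>}"
  proof (rule emeasure_mono)
    show "B \<subseteq> {- \<bar>c\<bar> - 1<..\<bar>c\<bar>}" using c by force
  qed simp
  also have "\<dots> < \<infinity>"
    using assms by (subst emeasure_intensity_Ioc) auto
  finally show ?thesis by simp
qed

lemma sigma_finite_intensity: "0 \<le> lam \<Longrightarrow> 0 < h \<Longrightarrow> sigma_finite_measure (intensity lam h)"
proof
  assume "0 \<le> lam" "0 < h"
  then have "emeasure (intensity lam h) {- real n<..real n} \<noteq> \<infinity>" for n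
    by (intro emeasure_intensity_bounded) auto
  moreover have "(\<Union>n. {- real n<..real n}) = UNIV"
  proof safe
    fix x :: real
    obtain n where "\<bar>x\<bar> < real n" using reals_Archimedean2 by blast
    then show "x \<in> (\<Union>i. {- real i<..real i})" by (intro UN_I[of n]) auto
  qed auto
  ultimately show "\<exists>A. countable A \<and> A \<subseteq> sets (intensity lam h) \<and> \<Union> A = space (intensity lam h)
      \<and> (\<forall>a\<in>A. emeasure (intensity lam h) a \<noteq> \<infinity>)"
    by (intro exI[of _ "range (\<lambda>n. {- real n<..real n})"]) auto
qed

lemma mono_cum_intensity: "0 \<le> lam \<Longrightarrow> 0 < h \<Longrightarrow> mono (cum_intensity lam h)"
  by (rule monoI) (auto simp: cum_intensity_def intro!: mult_nonneg_nonneg mult_left_mono power_mono)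

lemma cum_intensity_nonneg: "0 \<le> lam \<Longrightarrow> 0 < h \<Longrightarrow> 0 \<le> cum_intensity lam h t"
  by (auto simp: cum_intensity_def intro!: mult_nonneg_nonneg power_mono)

lemma cum_intensity_lipschitz:
  assumes "0 \<le> lam" "0 < h" "x \<le> y" "y \<le> b"
  shows "cum_intensity lam h y - cum_intensity lam h x \<le> 2 * pi * lam * \<bar>b\<bar> * (y - x)"
proof (cases "y < h")
  case True
  then show ?thesis using assms by (auto simp: cum_intensity_def)
next
  case False
  define c where "c = max x h"
  have c: "0 < c" "x \<le> c" "c \<le> y" using False assms by (auto simp: c_def)
  have "cum_intensity lam h y - cum_intensity lam h x = pi * lam * (y\<^sup>2 - c\<^sup>2)"
    using False by (auto simp: cum_intensity_def c_def max_def algebra_simps)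
  also have "\<dots> = pi * lam * ((y + c) * (y - c))"
    by (simp add: power2_eq_square algebra_simps)
  also have "\<dots> \<le> pi * lam * ((2 * \<bar>b\<bar>) * (y - x))"
    using c assms by (intro mult_left_mono mult_mono) auto
  finally show ?thesis by (simp add: mult_ac)
qed

lemma cum_intensity_measurable [measurable]: "cum_intensity lam h \<in> borel_measurable borel"
  unfolding cum_intensity_def[abs_def] by measurable

locale fading_network = prob_space M for M :: "'a measure" +
  fixes D g :: "nat \<Rightarrow> 'a \<Rightarrow> real" and lam h :: real and m :: nat
  assumes lam_pos: "0 < lam" and h_pos: "0 < h" and m_pos: "1 \<le> m"
    and D_measurable [measurable]: "\<And>n. D n \<in> borel_measurable M"
    and D_ge: "\<And>n \<omega>. h \<le> D n \<omega>"
    and finite_points: "\<And>B. B \<in> sets borel \<Longrightarrow> bounded B \<Longrightarrow> AE \<omega> in M. finite {n. D n \<omega> \<in> B}"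
    and count_poisson: "\<And>B k. B \<in> sets borel \<Longrightarrow> bounded B \<Longrightarrow>
          measure M {\<omega> \<in> space M. card {n. D n \<omega> \<in> B} = k}
          = measure (intensity lam h) B ^ k / fact k * exp (- measure (intensity lam h) B)"
    and count_indep: "\<And>(I :: nat set) B. (\<And>i. i \<in> I \<Longrightarrow> B i \<in> sets borel \<and> bounded (B i)) \<Longrightarrow>
          disjoint_family_on B I \<Longrightarrow>
          indep_vars (\<lambda>_. count_space UNIV) (\<lambda>i \<omega>. card {n. D n \<omega> \<in> B i}) I"
    and fading_erlang: "\<And>n. distributed M lborel (g n) (erlang_density (m - 1) (real m))"
    and fading_indep: "indep_vars (\<lambda>_. borel) g UNIV"
    and points_fading_indep: "indep_var (Pi\<^sub>M UNIV (\<lambda>_. borel)) (\<lambda>\<omega> n. D n \<omega>)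
          (Pi\<^sub>M UNIV (\<lambda>_. borel)) (\<lambda>\<omega> n. g n \<omega>)"
begin

definition cnt :: "real set \<Rightarrow> 'a \<Rightarrow> nat" where
  "cnt B \<omega> = card {n. D n \<omega> \<in> B}"

abbreviation "Lam \<equiv> intensity lam h"
abbreviation "V \<equiv> cum_intensity lam h"

lemma cnt_measurable:
  assumes "B \<in> sets borel" "bounded B"
  shows "cnt B \<in> measurable M (count_space UNIV)"
proof -
  have "indep_vars (\<lambda>_. count_space UNIV) (\<lambda>i. cnt B) {0::nat}"
    using count_indep[of "{0}" "\<lambda>_. B"] assms by (simp add: disjoint_family_on_def cnt_def[abs_def])
  then show ?thesis by (simp add: indep_vars_def)
qed

lemma g_measurable [measurable]: "g n \<in> borel_measurable M"
  using distributed_measurable[OF fading_erlang[of n]] by simp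

lemma nn_integral_cnt:
  assumes B: "B \<in> sets borel" "bounded B"
  shows "(\<integral>\<^sup>+\<omega>. f (cnt B \<omega>) \<partial>M)
    = (\<Sum>k. f k * ennreal (measure Lam B ^ k / fact k * exp (- measure Lam B)))"
proof -
  note [measurable] = cnt_measurable[OF B]
  have "(\<integral>\<^sup>+\<omega>. f (cnt B \<omega>) \<partial>M)
      = (\<integral>\<^sup>+\<omega>. (\<Sum>k. f k * indicator {\<omega>\<in>space M. cnt B \<omega> = k} \<omega>) \<partial>M)"
  proof (rule nn_integral_cong)
    fix \<omega> assume "\<omega> \<in> space M"
    have "(\<Sum>k. f k * indicator {\<omega>\<in>space M. cnt B \<omega> = k} \<omega>)
        = (\<Sum>k\<in>{cnt B \<omega>}. f k * indicator {\<omega>\<in>space M. cnt B \<omega> = k} \<omega>)"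
      by (rule suminf_finite) auto
    then show "f (cnt B \<omega>) = (\<Sum>k. f k * indicator {\<omega>\<in>space M. cnt B \<omega> = k} \<omega>)"
      using \<open>\<omega> \<in> space M\<close> by simp
  qed
  also have "\<dots> = (\<Sum>k. \<integral>\<^sup>+\<omega>. f k * indicator {\<omega>\<in>space M. cnt B \<omega> = k} \<omega> \<partial>M)"
    by (rule nn_integral_suminf) measurable
  also have "\<dots> = (\<Sum>k. f k * ennreal (measure Lam B ^ k / fact k * exp (- measure Lam B)))"
  proof (intro suminf_cong)
    fix k
    have "{\<omega>\<in>space M. cnt B \<omega> = k} \<in> events" by measurable
    then show "(\<integral>\<^sup>+\<omega>. f k * indicator {\<omega>\<in>space M. cnt B \<omega> = k} \<omega> \<partial>M)
        = f k * ennreal (measure Lam B ^ k / fact k * exp (- measure Lam B))"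
      using count_poisson[OF B, of k]
      by (subst nn_integral_cmult_indicator) (auto simp: emeasure_eq_measure cnt_def)
  qed
  finally show ?thesis .
qed

lemma cnt_laplace:
  assumes B: "B \<in> sets borel" "bounded B"
  shows "(\<integral>\<^sup>+\<omega>. ennreal (exp (- y * real (cnt B \<omega>))) \<partial>M)
    = ennreal (exp (- ((1 - exp (- y)) * measure Lam B)))"
proof -
  define p where "p = measure Lam B"
  have s: "(\<lambda>k. exp (- p) * ((exp (- y) * p) ^ k /\<^sub>R fact k)) sums (exp (- p) * exp (exp (- y) * p))"
    by (intro sums_mult exp_converges)
  have "(\<integral>\<^sup>+\<omega>. ennreal (exp (- y * real (cnt B \<omega>))) \<partial>M)
      = (\<Sum>k. ennreal (exp (- y * real k)) * ennreal (p ^ k / fact k * exp (- p)))"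
    using nn_integral_cnt[OF B, of "\<lambda>k. ennreal (exp (- y * real k))"] by (simp add: p_def)
  also have "\<dots> = (\<Sum>k. ennreal (exp (- p) * ((exp (- y) * p) ^ k /\<^sub>R fact k)))"
  proof (intro suminf_cong)
    fix k
    have "exp (- y * real k) = exp (- y) ^ k" by (simp add: exp_of_nat_mult[symmetric] mult.commute)
    then show "ennreal (exp (- y * real k)) * ennreal (p ^ k / fact k * exp (- p))
      = ennreal (exp (- p) * ((exp (- y) * p) ^ k /\<^sub>R fact k))"
      by (simp add: ennreal_mult[symmetric] p_def power_mult_distrib divide_inverse mult_ac)
  qed
  also have "\<dots> = ennreal (exp (- p) * exp (exp (- y) * p))"
    using s by (intro suminf_ennreal_eq) (auto simp: p_def)
  also have "exp (- p) * exp (exp (- y) * p) = exp (- ((1 - exp (- y)) * p))"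
    by (simp add: exp_add[symmetric] algebra_simps)
  finally show ?thesis by (simp add: p_def)
qed

lemma nn_integral_prod_cnt:
  fixes I :: "'i set" and f :: "'i \<Rightarrow> nat \<Rightarrow> ennreal"
  assumes "finite I" and B: "\<And>i. i \<in> I \<Longrightarrow> B i \<in> sets borel" "\<And>i. i \<in> I \<Longrightarrow> bounded (B i)"
    and disj: "disjoint_family_on B I"
  shows "(\<integral>\<^sup>+\<omega>. (\<Prod>i\<in>I. f i (cnt (B i) \<omega>)) \<partial>M) = (\<Prod>i\<in>I. \<integral>\<^sup>+\<omega>. f i (cnt (B i) \<omega>) \<partial>M)"
proof -
  obtain e where e: "bij_betw e {0..<card I} I"
    using ex_bij_betw_nat_finite[OF \<open>finite I\<close>] by blast
  let ?J = "{0..<card I}"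
  have eI: "e i \<in> I" if "i \<in> ?J" for i using e that by (auto simp: bij_betw_def)
  have inj: "inj_on e ?J" using e by (simp add: bij_betw_def)
  have "indep_vars (\<lambda>_. count_space UNIV) (\<lambda>i. cnt (B (e i))) ?J"
    unfolding cnt_def
  proof (rule count_indep)
    show "disjoint_family_on (\<lambda>i. B (e i)) ?J"
      unfolding disjoint_family_on_def
    proof (intro ballI impI)
      fix i j assume ij: "i \<in> ?J" "j \<in> ?J" "i \<noteq> j"
      then have "e i \<noteq> e j" using inj by (auto dest: inj_onD)
      then show "B (e i) \<inter> B (e j) = {}"
        using disj ij eI by (auto simp: disjoint_family_on_def)
    qed
  qed (use B eI in auto)
  then have "indep_vars (\<lambda>_. borel) (\<lambda>i \<omega>. f (e i) (cnt (B (e i)) \<omega>)) ?J"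
    by (rule indep_vars_compose2) auto
  then have "(\<integral>\<^sup>+\<omega>. (\<Prod>i\<in>?J. f (e i) (cnt (B (e i)) \<omega>)) \<partial>M)
      = (\<Prod>i\<in>?J. \<integral>\<^sup>+\<omega>. f (e i) (cnt (B (e i)) \<omega>) \<partial>M)"
    by (intro indep_vars_nn_integral) auto
  then show ?thesis
    using prod.reindex_bij_betw[OF e, of "\<lambda>i. f i (cnt (B i) \<omega>)" for \<omega>]
      prod.reindex_bij_betw[OF e, of "\<lambda>i. \<integral>\<^sup>+\<omega>. f i (cnt (B i) \<omega>) \<partial>M"]
    by simp
qed

lemma suminf_simple_points:
  fixes v :: "real \<Rightarrow> real"
  assumes v: "simple_function borel v" "\<And>t. 0 \<le> v t"
    and fin: "finite {n. v (D n \<omega>) \<noteq> 0}"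
  shows "(\<Sum>n. ennreal (v (D n \<omega>))) = ennreal (\<Sum>y\<in>range v - {0}. y * real (cnt (v -` {y}) \<omega>))"
proof -
  let ?K = "{n. v (D n \<omega>) \<noteq> 0}" and ?S = "range v - {0}"
  have S: "finite ?S" using simple_functionD(1)[OF v(1)] by simp
  have "(\<Sum>n. ennreal (v (D n \<omega>))) = (\<Sum>n\<in>?K. ennreal (v (D n \<omega>)))"
    using fin by (rule suminf_finite) auto
  also have "\<dots> = ennreal (\<Sum>n\<in>?K. v (D n \<omega>))"
    using v by simp
  also have "(\<Sum>n\<in>?K. v (D n \<omega>)) = (\<Sum>y\<in>?S. \<Sum>n\<in>{n\<in>?K. v (D n \<omega>) = y}. v (D n \<omega>))"
    by (rule sum.group[symmetric]) (use S fin in auto)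
  also have "\<dots> = (\<Sum>y\<in>?S. y * real (cnt (v -` {y}) \<omega>))"
  proof (rule sum.cong[OF refl])
    fix y assume y: "y \<in> ?S"
    have "{n\<in>?K. v (D n \<omega>) = y} = {n. D n \<omega> \<in> v -` {y}}" using y by auto
    then have "(\<Sum>n\<in>{n\<in>?K. v (D n \<omega>) = y}. v (D n \<omega>)) = (\<Sum>n\<in>{n. D n \<omega> \<in> v -` {y}}. y)"
      by (intro sum.cong) auto
    then show "(\<Sum>n\<in>{n\<in>?K. v (D n \<omega>) = y}. v (D n \<omega>)) = y * real (cnt (v -` {y}) \<omega>)"
      by (simp add: cnt_def)
  qed
  finally show ?thesis .
qed

text \<open>
  The left endpoint \<open>-1\<close> only keeps the set bounded: all points are positive, so \<open>{-1<..a}\<close> contains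
  exactly the points up to \<open>a\<close>. The factors \<open>f0\<close>, \<open>f1\<close> carry the independence of the far field from the near counts.
\<close>

lemma laplace_functional_simple:
  fixes v :: "real \<Rightarrow> real" and f0 f1 :: "nat \<Rightarrow> ennreal"
  assumes v: "simple_function borel v" "\<And>t. 0 \<le> v t"
    and supp: "\<And>t. t \<notin> {b<..T} \<Longrightarrow> v t = 0" and ab: "a \<le> b"
  shows "(\<integral>\<^sup>+\<omega>. f0 (cnt {-1<..a} \<omega>) * f1 (cnt {a<..b} \<omega>) * ennreal (exp_neg (\<Sum>n. ennreal (v (D n \<omega>)))) \<partial>M)
    = (\<integral>\<^sup>+\<omega>. f0 (cnt {-1<..a} \<omega>) \<partial>M) * (\<integral>\<^sup>+\<omega>. f1 (cnt {a<..b} \<omega>) \<partial>M)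
      * ennreal (exp_neg (\<integral>\<^sup>+t. ennreal (1 - exp (- v t)) \<partial>Lam))"
proof -
  define S where "S = range v - {0}"
  have S: "finite S" using simple_functionD(1)[OF v(1)] by (simp add: S_def)
  have Spos: "0 < y" if "y \<in> S" for y
    using that v(2) by (auto simp: S_def order_less_le)
  have sub: "v -` {y} \<subseteq> {b<..T}" if "y \<in> S" for y
  proof
    fix t assume "t \<in> v -` {y}"
    then have "v t \<noteq> 0" using that by (auto simp: S_def)
    then show "t \<in> {b<..T}" using supp by blast
  qed
  have meas: "v -` {y} \<in> sets borel" for y
    using simple_functionD(2)[OF v(1), of "{y}"] by simp
  have bdd: "bounded (v -` {y})" if "y \<in> S" for y
    using sub[OF that] bounded_subset[of "{b<..T}"] by auto
  \<comment> \<open>The values in \<open>S\<close> are positive, so \<open>-2\<close> and \<open>-1\<close> are free to index the two extra sets.\<close>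
  define B where "B y = (if y = -2 then {-1<..a} else if y = -1 then {a<..b} else v -` {y})" for y
  define F where "F y = (if y = -2 then f0 else if y = -1 then f1 else (\<lambda>k. ennreal (exp (- y * real k))))" for y
  have nS: "-2 \<notin> S" "-1 \<notin> S" using Spos[of "-2"] Spos[of "-1"] by auto
  have BS: "B y = v -` {y}" "F y = (\<lambda>k. ennreal (exp (- y * real k)))" if "y \<in> S" for y
    using that nS by (auto simp: B_def F_def)
  let ?I = "insert (-2) (insert (-1) S)"
  have split_I: "(\<Prod>y\<in>?I. c y) = c (-2) * c (-1) * (\<Prod>y\<in>S. c y)" for c :: "real \<Rightarrow> ennreal"
    using S nS by (simp add: mult_ac)
  have "(\<integral>\<^sup>+\<omega>. f0 (cnt {-1<..a} \<omega>) * f1 (cnt {a<..b} \<omega>) * ennreal (exp_neg (\<Sum>n. ennreal (v (D n \<omega>)))) \<partial>M)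
      = (\<integral>\<^sup>+\<omega>. (\<Prod>y\<in>?I. F y (cnt (B y) \<omega>)) \<partial>M)"
  proof (rule nn_integral_cong_AE)
    have "AE \<omega> in M. finite {n. D n \<omega> \<in> {b<..T}}"
      by (rule finite_points) auto
    then show "AE \<omega> in M. f0 (cnt {-1<..a} \<omega>) * f1 (cnt {a<..b} \<omega>) * ennreal (exp_neg (\<Sum>n. ennreal (v (D n \<omega>))))
        = (\<Prod>y\<in>?I. F y (cnt (B y) \<omega>))"
    proof eventually_elim
      case (elim \<omega>)
      have "finite {n. v (D n \<omega>) \<noteq> 0}"
        by (rule finite_subset[OF _ elim]) (use supp in auto)
      from suminf_simple_points[OF v this]
      have "exp_neg (\<Sum>n. ennreal (v (D n \<omega>))) = exp (- (\<Sum>y\<in>S. y * real (cnt (v -` {y}) \<omega>)))"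
        using Spos by (simp add: S_def[symmetric] exp_neg_ennreal sum_nonneg less_imp_le)
      also have "\<dots> = (\<Prod>y\<in>S. exp (- y * real (cnt (v -` {y}) \<omega>)))"
        using S by (simp add: exp_sum[symmetric] sum_negf)
      finally have "ennreal (exp_neg (\<Sum>n. ennreal (v (D n \<omega>)))) = (\<Prod>y\<in>S. F y (cnt (B y) \<omega>))"
        using BS by (simp add: prod_ennreal)
      then show ?case by (simp only: split_I) (simp add: B_def F_def)
    qed
  qed
  also have "\<dots> = (\<Prod>y\<in>?I. \<integral>\<^sup>+\<omega>. F y (cnt (B y) \<omega>) \<partial>M)"
  proof (rule nn_integral_prod_cnt)
    show "disjoint_family_on B ?I"
      unfolding disjoint_family_on_def
    proof (intro ballI impI)
      have aux: "B x \<inter> B y = {}" if xy: "x \<in> ?I" "y \<in> ?I" "x < y" for x y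
      proof -
        consider "x = -2" "y = -1" | "x = -2" "y \<in> S" | "x = -1" "y \<in> S" | "x \<in> S" "y \<in> S"
          using xy Spos[of x] by auto
        then show ?thesis
          using sub[of y] ab BS xy(3) by cases (auto simp: B_def)
      qed
      fix x y assume "x \<in> ?I" "y \<in> ?I" "x \<noteq> y"
      then show "B x \<inter> B y = {}"
        using aux[of x y] aux[of y x] by (cases "x < y") auto
    qed
    show "B i \<in> sets borel" "bounded (B i)" if "i \<in> ?I" for i
      using that meas bdd by (auto simp: B_def)
  qed (use S in auto)
  also have "\<dots> = (\<integral>\<^sup>+\<omega>. f0 (cnt {-1<..a} \<omega>) \<partial>M) * (\<integral>\<^sup>+\<omega>. f1 (cnt {a<..b} \<omega>) \<partial>M)
      * (\<Prod>y\<in>S. \<integral>\<^sup>+\<omega>. F y (cnt (B y) \<omega>) \<partial>M)"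
    by (simp only: split_I) (simp add: B_def F_def)
  also have "(\<Prod>y\<in>S. \<integral>\<^sup>+\<omega>. F y (cnt (B y) \<omega>) \<partial>M)
      = (\<Prod>y\<in>S. ennreal (exp (- ((1 - exp (- y)) * measure Lam (v -` {y})))))"
  proof (rule prod.cong[OF refl])
    fix y assume y: "y \<in> S"
    show "(\<integral>\<^sup>+\<omega>. F y (cnt (B y) \<omega>) \<partial>M) = ennreal (exp (- ((1 - exp (- y)) * measure Lam (v -` {y}))))"
      using cnt_laplace[OF meas bdd[OF y]] by (simp add: BS[OF y])
  qed
  also have "\<dots> = ennreal (exp (- (\<Sum>y\<in>S. (1 - exp (- y)) * measure Lam (v -` {y}))))"
    using S by (simp add: prod_ennreal exp_sum[symmetric] sum_negf)
  also have "exp (- (\<Sum>y\<in>S. (1 - exp (- y)) * measure Lam (v -` {y})))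
      = exp_neg (\<integral>\<^sup>+t. ennreal (1 - exp (- v t)) \<partial>Lam)"
  proof -
    have "(\<integral>\<^sup>+t. ennreal (1 - exp (- v t)) \<partial>Lam)
        = (\<integral>\<^sup>+t. (\<Sum>y\<in>S. ennreal (1 - exp (- y)) * indicator (v -` {y}) t) \<partial>Lam)"
    proof (rule nn_integral_cong)
      fix t
      have "(\<Sum>y\<in>S. ennreal (1 - exp (- y)) * indicator (v -` {y}) t)
          = (\<Sum>y\<in>S. if y = v t then ennreal (1 - exp (- y)) else 0)"
        by (intro sum.cong) auto
      also have "\<dots> = ennreal (1 - exp (- v t))"
        using S by (subst sum.delta) (auto simp: S_def)
      finally show "ennreal (1 - exp (- v t)) = (\<Sum>y\<in>S. ennreal (1 - exp (- y)) * indicator (v -` {y}) t)" ..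
    qed
    also have "\<dots> = (\<Sum>y\<in>S. ennreal (1 - exp (- y)) * emeasure Lam (v -` {y}))"
      using meas by (subst nn_integral_sum) (auto simp: nn_integral_cmult_indicator)
    also have "\<dots> = (\<Sum>y\<in>S. ennreal ((1 - exp (- y)) * measure Lam (v -` {y})))"
    proof (rule sum.cong[OF refl])
      fix y assume y: "y \<in> S"
      have "emeasure Lam (v -` {y}) = ennreal (measure Lam (v -` {y}))"
        using emeasure_intensity_bounded[OF _ h_pos bdd[OF y]] lam_pos
        by (intro emeasure_eq_ennreal_measure) auto
      then show "ennreal (1 - exp (- y)) * emeasure Lam (v -` {y})
          = ennreal ((1 - exp (- y)) * measure Lam (v -` {y}))"
        using Spos[OF y] by (simp add: ennreal_mult[symmetric])
    qed
    also have "\<dots> = ennreal (\<Sum>y\<in>S. (1 - exp (- y)) * measure Lam (v -` {y}))"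
      using Spos by (intro sum_ennreal) (auto simp: less_imp_le)
    finally show ?thesis
      using Spos by (simp add: exp_neg_ennreal sum_nonneg less_imp_le)
  qed
  finally show ?thesis .
qed

lemma laplace_functional:
  fixes u :: "real \<Rightarrow> ennreal" and f0 f1 :: "nat \<Rightarrow> ennreal"
  assumes u [measurable]: "u \<in> borel_measurable borel" and ab: "a \<le> b"
    and f: "\<And>k. f0 k \<le> 1" "\<And>k. f1 k \<le> 1"
  shows "(\<integral>\<^sup>+\<omega>. f0 (cnt {-1<..a} \<omega>) * f1 (cnt {a<..b} \<omega>)
        * ennreal (exp_neg (\<Sum>n. u (D n \<omega>) * indicator {b<..} (D n \<omega>))) \<partial>M)
    = (\<integral>\<^sup>+\<omega>. f0 (cnt {-1<..a} \<omega>) \<partial>M) * (\<integral>\<^sup>+\<omega>. f1 (cnt {a<..b} \<omega>) \<partial>M)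
      * ennreal (exp_neg (\<integral>\<^sup>+t. ennreal (1 - exp_neg (u t)) * indicator {b<..} t \<partial>Lam))"
proof -
  obtain s where s: "\<And>i. simple_function borel (s i)" "incseq s" "\<And>i x. s i x < top" "\<And>x. (SUP i. s i x) = u x"
    using borel_measurable_implies_simple_function_sequence'[OF u] by blast
  have s_inc: "s i x \<le> s j x" if "i \<le> j" for i j x
    using s(2) that by (auto simp: incseq_def le_fun_def)
  define v where "v i t = enn2real (s i t) * indicator {b<..real i} t" for i t
  have ev: "ennreal (v i t) = s i t * indicator {b<..real i} t" for i t
    using s(3)[of i t] by (auto simp: v_def split: split_indicator)
  have sup: "(SUP i. ennreal (v i t)) = u t * indicator {b<..} t" for t
  proof (cases "b < t")
    case False
    then show ?thesis by (simp add: ev)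
  next
    case True
    obtain j where j: "t \<le> real j" using real_arch_simple by blast
    have "(SUP i. ennreal (v i t)) = u t"
    proof (rule antisym)
      show "(SUP i. ennreal (v i t)) \<le> u t"
        unfolding ev s(4)[symmetric]
        by (intro SUP_mono) (auto split: split_indicator)
      show "u t \<le> (SUP i. ennreal (v i t))"
        unfolding s(4)[symmetric]
      proof (rule SUP_mono)
        fix i
        have "s i t \<le> s (max i j) t" by (rule s_inc) simp
        also have "\<dots> = ennreal (v (max i j) t)"
          using True j by (auto simp: ev split: split_indicator)
        finally show "\<exists>k\<in>UNIV. s i t \<le> ennreal (v k t)" by blast
      qed
    qed
    then show ?thesis using True by simp
  qed
  have inc: "incseq (\<lambda>i. ennreal (v i t))" for t
    using s_inc by (auto intro!: incseq_SucI simp: ev split: split_indicator)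
  have simple: "simple_function borel (v i)" for i
  proof -
    have "simple_function borel (\<lambda>t. enn2real (s i t))"
      using simple_function_compose[OF s(1)[of i], of enn2real] by (simp add: comp_def)
    then show ?thesis
      unfolding v_def[abs_def] by (intro simple_function_mult simple_function_indicator) auto
  qed
  have [measurable]: "v i \<in> borel_measurable borel" for i
    using simple by (rule borel_measurable_simple_function)
  note [measurable] = cnt_measurable[of "{-1<..a}", simplified] cnt_measurable[of "{a<..b}", simplified]
  let ?L = "\<lambda>x. f0 (cnt {-1<..a} x) * f1 (cnt {a<..b} x)"
  have L1: "?L x \<le> 1" for x using f mult_mono[of "f0 (cnt {-1<..a} x)" 1 "f1 (cnt {a<..b} x)" 1] by simp
  have [measurable]: "?L \<in> borel_measurable M" by measurable
  have "(\<lambda>i. \<integral>\<^sup>+\<omega>. ?L \<omega> * ennreal (exp_neg (\<Sum>n. ennreal (v i (D n \<omega>)))) \<partial>M)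
    \<longlonglongrightarrow> (\<integral>\<^sup>+\<omega>. ?L \<omega> * ennreal (exp_neg (\<Sum>n. u (D n \<omega>) * indicator {b<..} (D n \<omega>))) \<partial>M)"
  proof (rule nn_integral_dominated_convergence[where w = "\<lambda>_. 1"])
    show "AE x in M. ?L x * ennreal (exp_neg (\<Sum>n. ennreal (v i (D n x)))) \<le> 1" for i
      using L1 mult_mono[of "?L x" 1 "ennreal (exp_neg (\<Sum>n. ennreal (v i (D n x))))" 1 for x]
      by (intro AE_I2) simp
    show "AE x in M. (\<lambda>i. ?L x * ennreal (exp_neg (\<Sum>n. ennreal (v i (D n x)))))
        \<longlonglongrightarrow> ?L x * ennreal (exp_neg (\<Sum>n. u (D n x) * indicator {b<..} (D n x)))"
    proof (intro AE_I2)
      fix x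
      have "(\<Sum>n. u (D n x) * indicator {b<..} (D n x)) = (SUP i. \<Sum>n. ennreal (v i (D n x)))"
        unfolding sup[symmetric] by (rule ennreal_suminf_SUP_eq) (rule inc)
      moreover have "incseq (\<lambda>i. \<Sum>n. ennreal (v i (D n x)))"
        using inc by (auto intro!: incseq_SucI suminf_le summableI simp: incseq_Suc_iff)
      ultimately have "(\<lambda>i. exp_neg (\<Sum>n. ennreal (v i (D n x))))
          \<longlonglongrightarrow> exp_neg (\<Sum>n. u (D n x) * indicator {b<..} (D n x))"
        using tendsto_exp_neg_SUP by simp
      then have "(\<lambda>i. ennreal (exp_neg (\<Sum>n. ennreal (v i (D n x)))))
          \<longlonglongrightarrow> ennreal (exp_neg (\<Sum>n. u (D n x) * indicator {b<..} (D n x)))"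
        by (rule tendsto_ennrealI)
      then show "(\<lambda>i. ?L x * ennreal (exp_neg (\<Sum>n. ennreal (v i (D n x)))))
        \<longlonglongrightarrow> ?L x * ennreal (exp_neg (\<Sum>n. u (D n x) * indicator {b<..} (D n x)))"
        using L1[of x] by (intro ennreal_tendsto_cmult) (auto simp: less_top[symmetric] top_unique)
    qed
  qed (auto simp: emeasure_space_1)
  moreover have "(\<integral>\<^sup>+\<omega>. ?L \<omega> * ennreal (exp_neg (\<Sum>n. ennreal (v i (D n \<omega>)))) \<partial>M)
    = (\<integral>\<^sup>+\<omega>. f0 (cnt {-1<..a} \<omega>) \<partial>M) * (\<integral>\<^sup>+\<omega>. f1 (cnt {a<..b} \<omega>) \<partial>M)
      * ennreal (exp_neg (\<integral>\<^sup>+t. ennreal (1 - exp (- v i t)) \<partial>Lam))" for i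
    by (rule laplace_functional_simple[OF simple _ _ ab, where T = "real i"]) (auto simp: v_def)
  moreover have "(\<lambda>i. (\<integral>\<^sup>+\<omega>. f0 (cnt {-1<..a} \<omega>) \<partial>M) * (\<integral>\<^sup>+\<omega>. f1 (cnt {a<..b} \<omega>) \<partial>M)
      * ennreal (exp_neg (\<integral>\<^sup>+t. ennreal (1 - exp (- v i t)) \<partial>Lam)))
    \<longlonglongrightarrow> (\<integral>\<^sup>+\<omega>. f0 (cnt {-1<..a} \<omega>) \<partial>M) * (\<integral>\<^sup>+\<omega>. f1 (cnt {a<..b} \<omega>) \<partial>M)
      * ennreal (exp_neg (\<integral>\<^sup>+t. ennreal (1 - exp_neg (u t)) * indicator {b<..} t \<partial>Lam))"
  proof (rule ennreal_tendsto_cmult)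
    have "(\<integral>\<^sup>+\<omega>. f0 (cnt {-1<..a} \<omega>) \<partial>M) \<le> (\<integral>\<^sup>+\<omega>. 1 \<partial>M)" "(\<integral>\<^sup>+\<omega>. f1 (cnt {a<..b} \<omega>) \<partial>M) \<le> (\<integral>\<^sup>+\<omega>. 1 \<partial>M)"
      by (intro nn_integral_mono f)+
    then have "(\<integral>\<^sup>+\<omega>. f0 (cnt {-1<..a} \<omega>) \<partial>M) * (\<integral>\<^sup>+\<omega>. f1 (cnt {a<..b} \<omega>) \<partial>M) \<le> 1 * 1"
      by (intro mult_mono) (auto simp: emeasure_space_1)
    also have "\<dots> < (top::ennreal)" by simp
    finally show "(\<integral>\<^sup>+\<omega>. f0 (cnt {-1<..a} \<omega>) \<partial>M) * (\<integral>\<^sup>+\<omega>. f1 (cnt {a<..b} \<omega>) \<partial>M) < top" .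
    have lim: "(\<lambda>i. ennreal (1 - exp (- v i t))) \<longlonglongrightarrow> ennreal (1 - exp_neg (u t)) * indicator {b<..} t" for t
    proof -
      have "(\<lambda>i. ennreal (v i t)) \<longlonglongrightarrow> u t * indicator {b<..} t"
        using LIMSEQ_SUP[OF inc[of t]] by (simp add: sup)
      then have "(\<lambda>i. ennreal (1 - exp_neg (ennreal (v i t)))) \<longlonglongrightarrow> ennreal (1 - exp_neg (u t * indicator {b<..} t))"
        by (intro tendsto_ennrealI tendsto_intros tendsto_exp_neg)
      moreover have "exp_neg (ennreal (v i t)) = exp (- v i t)" for i
        by (rule exp_neg_ennreal) (simp add: v_def)
      ultimately show ?thesis by (cases "b < t") auto
    qed
    have "(\<lambda>i. \<integral>\<^sup>+t. ennreal (1 - exp (- v i t)) \<partial>Lam)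
        \<longlonglongrightarrow> (\<integral>\<^sup>+t. ennreal (1 - exp_neg (u t)) * indicator {b<..} t \<partial>Lam)"
    proof (rule nn_integral_LIMSEQ)
      have "v i t \<le> v (Suc i) t" for i t
        using inc[of t] by (auto simp: incseq_Suc_iff v_def)
      then show "incseq (\<lambda>i t. ennreal (1 - exp (- v i t)))"
        by (intro incseq_SucI le_funI ennreal_leI) auto
    qed (use lim in auto)
    then show "(\<lambda>i. ennreal (exp_neg (\<integral>\<^sup>+t. ennreal (1 - exp (- v i t)) \<partial>Lam)))
      \<longlonglongrightarrow> ennreal (exp_neg (\<integral>\<^sup>+t. ennreal (1 - exp_neg (u t)) * indicator {b<..} t \<partial>Lam))"
      by (intro tendsto_ennrealI tendsto_exp_neg)
  qed
  ultimately show ?thesis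
    by (simp add: LIMSEQ_unique)
qed

end

section \<open>Interference with Erlang fading\<close>

lemma card_points_eq:
  "card {n::nat. x n \<in> B} = nat \<lfloor>enn2real (\<Sum>n. indicator B (x n))\<rfloor>"
proof -
  have "(\<Sum>n. indicator B (x n)) = (\<Sum>n. indicator {n. x n \<in> B} n :: ennreal)"
    by (intro suminf_cong) (auto split: split_indicator)
  also have "\<dots> = emeasure (count_space UNIV) {n. x n \<in> B}"
    by (simp add: nn_integral_count_space_nat[symmetric] del: nn_integral_indicator)
       (subst nn_integral_indicator, auto)
  finally show ?thesis
    by (cases "finite {n. x n \<in> B}") (auto simp: emeasure_count_space)
qed

lemma exp_neg_erlang_exponent:
  assumes "1 \<le> m" "0 \<le> c"
  shows "exp_neg (ennreal (real m * ln (1 + c / real m))) = (real m / (real m + c)) ^ m"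
proof -
  have "exp_neg (ennreal (real m * ln (1 + c / real m))) = exp (- (real m * ln (1 + c / real m)))"
    using assms by (intro exp_neg_ennreal) (auto intro!: mult_nonneg_nonneg ln_ge_zero)
  also have "\<dots> = exp (real m * ln (real m / (real m + c)))"
    using assms by (auto simp: ln_div field_simps)
  also have "\<dots> = exp (ln (real m / (real m + c))) ^ m"
    by (simp add: exp_of_nat_mult)
  also have "\<dots> = (real m / (real m + c)) ^ m"
    using assms by (subst exp_ln) auto
  finally show ?thesis .
qed

context fading_network
begin

lemma nn_integral_points_fading:
  assumes f: "f \<in> borel_measurable (Pi\<^sub>M UNIV (\<lambda>_. borel) \<Otimes>\<^sub>M Pi\<^sub>M UNIV (\<lambda>_. borel))"
  shows "(\<integral>\<^sup>+\<omega>. f ((\<lambda>n. D n \<omega>), (\<lambda>n. g n \<omega>)) \<partial>M) = (\<integral>\<^sup>+\<omega>'. \<integral>\<^sup>+\<omega>. f ((\<lambda>n. D n \<omega>'), (\<lambda>n. g n \<omega>)) \<partial>M \<partial>M)"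
proof -
  let ?P = "Pi\<^sub>M UNIV (\<lambda>_. borel) :: (nat \<Rightarrow> real) measure"
  have mD: "(\<lambda>\<omega> n. D n \<omega>) \<in> measurable M ?P" and mg: "(\<lambda>\<omega> n. g n \<omega>) \<in> measurable M ?P"
    using indep_var_rv1[OF points_fading_indep] indep_var_rv2[OF points_fading_indep] by auto
  interpret Pg: prob_space "distr M ?P (\<lambda>\<omega> n. g n \<omega>)" by (rule prob_space_distr[OF mg])
  have eq: "distr M ?P (\<lambda>\<omega> n. D n \<omega>) \<Otimes>\<^sub>M distr M ?P (\<lambda>\<omega> n. g n \<omega>)
      = distr M (?P \<Otimes>\<^sub>M ?P) (\<lambda>\<omega>. ((\<lambda>n. D n \<omega>), (\<lambda>n. g n \<omega>)))"
    using points_fading_indep by (simp add: indep_var_distribution_eq)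
  have "(\<integral>\<^sup>+\<omega>. f ((\<lambda>n. D n \<omega>), (\<lambda>n. g n \<omega>)) \<partial>M)
      = (\<integral>\<^sup>+p. f p \<partial>distr M (?P \<Otimes>\<^sub>M ?P) (\<lambda>\<omega>. ((\<lambda>n. D n \<omega>), (\<lambda>n. g n \<omega>))))"
    using f mD mg by (subst nn_integral_distr) auto
  also have "\<dots> = (\<integral>\<^sup>+p. f p \<partial>(distr M ?P (\<lambda>\<omega> n. D n \<omega>) \<Otimes>\<^sub>M distr M ?P (\<lambda>\<omega> n. g n \<omega>)))"
    by (simp add: eq)
  also have "\<dots> = (\<integral>\<^sup>+x. \<integral>\<^sup>+y. f (x, y) \<partial>distr M ?P (\<lambda>\<omega> n. g n \<omega>) \<partial>distr M ?P (\<lambda>\<omega> n. D n \<omega>))"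
    using f by (subst Pg.nn_integral_fst) auto
  also have "\<dots> = (\<integral>\<^sup>+x. \<integral>\<^sup>+\<omega>. f (x, (\<lambda>n. g n \<omega>)) \<partial>M \<partial>distr M ?P (\<lambda>\<omega> n. D n \<omega>))"
    using f mg by (intro nn_integral_cong nn_integral_distr) auto
  also have "\<dots> = (\<integral>\<^sup>+\<omega>'. \<integral>\<^sup>+\<omega>. f ((\<lambda>n. D n \<omega>'), (\<lambda>n. g n \<omega>)) \<partial>M \<partial>M)"
    using f mg mD by (intro nn_integral_distr) auto
  finally show ?thesis .
qed

lemma fading_pos: "AE \<omega> in M. \<forall>n. 0 < g n \<omega>"
proof -
  have "AE \<omega> in M. 0 < g n \<omega>" for n
  proof (subst distributed_AE2[OF fading_erlang[of n]])
    show "AE x in lborel. 0 < ennreal (erlang_density (m - 1) (real m) x) \<longrightarrow> 0 < x"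
      using AE_lborel_singleton[of 0] by eventually_elim (auto simp: erlang_density_def)
  qed auto
  then show ?thesis by (simp add: AE_all_countable)
qed

lemma fading_laplace:
  assumes c: "\<And>n. 0 \<le> c n"
  shows "(\<integral>\<^sup>+\<omega>. ennreal (exp_neg (\<Sum>n. ennreal (c n * g n \<omega>))) \<partial>M)
    = ennreal (exp_neg (\<Sum>n. ennreal (real m * ln (1 + c n / real m))))"
proof -
  have m: "0 < real m" using m_pos by simp
  have "(\<lambda>N. \<integral>\<^sup>+\<omega>. ennreal (exp_neg (\<Sum>n<N. ennreal (c n * g n \<omega>))) \<partial>M)
    \<longlonglongrightarrow> (\<integral>\<^sup>+\<omega>. ennreal (exp_neg (\<Sum>n. ennreal (c n * g n \<omega>))) \<partial>M)"
    by (rule nn_integral_dominated_convergence[where w = "\<lambda>_. 1"])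
       (auto simp: emeasure_space_1 intro!: tendsto_ennrealI tendsto_exp_neg_suminf)
  moreover have "(\<integral>\<^sup>+\<omega>. ennreal (exp_neg (\<Sum>n<N. ennreal (c n * g n \<omega>))) \<partial>M)
    = ennreal (exp_neg (\<Sum>n<N. ennreal (real m * ln (1 + c n / real m))))" for N
  proof -
    have "(\<integral>\<^sup>+\<omega>. ennreal (exp_neg (\<Sum>n<N. ennreal (c n * g n \<omega>))) \<partial>M)
        = (\<integral>\<^sup>+\<omega>. (\<Prod>n<N. ennreal (exp (- c n * g n \<omega>))) \<partial>M)"
    proof (rule nn_integral_cong_AE)
      show "AE \<omega> in M. ennreal (exp_neg (\<Sum>n<N. ennreal (c n * g n \<omega>))) = (\<Prod>n<N. ennreal (exp (- c n * g n \<omega>)))"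
        using fading_pos
      proof eventually_elim
        case (elim \<omega>)
        then have "0 \<le> c n * g n \<omega>" for n using c by (simp add: less_imp_le)
        then show ?case
          by (simp add: exp_neg_sum exp_neg_ennreal prod_ennreal del: sum_ennreal)
      qed
    qed
    also have "\<dots> = (\<Prod>n<N. \<integral>\<^sup>+\<omega>. ennreal (exp (- c n * g n \<omega>)) \<partial>M)"
    proof (rule indep_vars_nn_integral)
      have "indep_vars (\<lambda>_. borel) g {..<N}"
        using fading_indep by (rule indep_vars_subset) simp
      then show "indep_vars (\<lambda>_. borel) (\<lambda>n \<omega>. ennreal (exp (- c n * g n \<omega>))) {..<N}"
        by (rule indep_vars_compose2) measurable
    qed auto
    also have "\<dots> = (\<Prod>n<N. ennreal ((real m / (real m + c n)) ^ m))"
    proof (rule prod.cong[OF refl])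
      fix n
      show "(\<integral>\<^sup>+\<omega>. ennreal (exp (- c n * g n \<omega>)) \<partial>M) = ennreal ((real m / (real m + c n)) ^ m)"
        using erlang_laplace_transform[OF fading_erlang m c] m_pos by simp
    qed
    also have "\<dots> = ennreal (exp_neg (\<Sum>n<N. ennreal (real m * ln (1 + c n / real m))))"
      using m_pos c by (simp add: exp_neg_sum exp_neg_erlang_exponent prod_ennreal del: sum_ennreal)
    finally show ?thesis .
  qed
  moreover have "(\<lambda>N. ennreal (exp_neg (\<Sum>n<N. ennreal (real m * ln (1 + c n / real m)))))
    \<longlonglongrightarrow> ennreal (exp_neg (\<Sum>n. ennreal (real m * ln (1 + c n / real m))))"
    by (intro tendsto_ennrealI tendsto_exp_neg_suminf)
  ultimately show ?thesis by (simp add: LIMSEQ_unique)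
qed

end

locale fading_link = fading_network +
  fixes w :: "real \<Rightarrow> real"
  assumes w_measurable [measurable]: "w \<in> borel_measurable borel" and w_pos: "\<And>t. 0 < w t"
begin

definition interf :: "real \<Rightarrow> 'a \<Rightarrow> ennreal" where
  "interf r \<omega> = (\<Sum>n. ennreal (w (D n \<omega>) * g n \<omega>) * indicator {r<..} (D n \<omega>))"

definition laplace :: "real \<Rightarrow> real \<Rightarrow> real" where
  "laplace s r = exp_neg (\<integral>\<^sup>+t. ennreal (1 - (real m / (real m + s * w t)) ^ m) * indicator {r<..} t \<partial>Lam)"

lemma interf_measurable_pair [measurable]:
  "(\<lambda>(r, \<omega>). interf r \<omega>) \<in> borel_measurable (borel \<Otimes>\<^sub>M M)"
  unfolding interf_def[abs_def] indicator_def greaterThan_iff by measurable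

lemma interf_measurable [measurable]: "interf r \<in> borel_measurable M"
  unfolding interf_def[abs_def] by measurable

lemma count_interf_laplace:
  assumes ab: "a \<le> b" and f: "\<And>k. f0 k \<le> 1" "\<And>k. f1 k \<le> 1" and s: "0 \<le> s"
  shows "(\<integral>\<^sup>+\<omega>. f0 (cnt {-1<..a} \<omega>) * f1 (cnt {a<..b} \<omega>) * ennreal (exp_neg (ennreal s * interf b \<omega>)) \<partial>M)
    = (\<integral>\<^sup>+\<omega>. f0 (cnt {-1<..a} \<omega>) \<partial>M) * (\<integral>\<^sup>+\<omega>. f1 (cnt {a<..b} \<omega>) \<partial>M) * ennreal (laplace s b)"
proof -
  define q where "q B x = nat \<lfloor>enn2real (\<Sum>n. indicator B (x n))\<rfloor>" for B and x :: "nat \<Rightarrow> real"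
  define c where "c x n = s * w (x n) * indicator {b<..} (x n)" for x :: "nat \<Rightarrow> real" and n
  have q: "cnt B \<omega> = q B (\<lambda>n. D n \<omega>)" for B \<omega>
    by (simp add: cnt_def q_def card_points_eq)
  have c0: "0 \<le> c x n" for x n
    using s w_pos[of "x n"] by (simp add: c_def)
  have cg: "ennreal s * interf b \<omega> = (\<Sum>n. ennreal (c (\<lambda>n. D n \<omega>) n * g n \<omega>))" for \<omega>
    unfolding interf_def ennreal_suminf_cmult[symmetric]
    using s by (intro suminf_cong) (auto simp: c_def ennreal_mult'[symmetric] mult_ac split: split_indicator)
  define F where "F = (\<lambda>(x, y). f0 (q {-1<..a} x) * f1 (q {a<..b} x) * ennreal (exp_neg (\<Sum>n. ennreal (c x n * y n))))"
  have [measurable]: "F \<in> borel_measurable (Pi\<^sub>M UNIV (\<lambda>_. borel) \<Otimes>\<^sub>M Pi\<^sub>M UNIV (\<lambda>_. borel))"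
    unfolding F_def q_def c_def by measurable
  have "(\<integral>\<^sup>+\<omega>. f0 (cnt {-1<..a} \<omega>) * f1 (cnt {a<..b} \<omega>) * ennreal (exp_neg (ennreal s * interf b \<omega>)) \<partial>M)
      = (\<integral>\<^sup>+\<omega>. F ((\<lambda>n. D n \<omega>), (\<lambda>n. g n \<omega>)) \<partial>M)"
    by (simp add: F_def q cg)
  also have "\<dots> = (\<integral>\<^sup>+\<omega>'. \<integral>\<^sup>+\<omega>. F ((\<lambda>n. D n \<omega>'), (\<lambda>n. g n \<omega>)) \<partial>M \<partial>M)"
    by (rule nn_integral_points_fading) measurable
  also have "\<dots> = (\<integral>\<^sup>+\<omega>. f0 (cnt {-1<..a} \<omega>) * f1 (cnt {a<..b} \<omega>)
      * ennreal (exp_neg (\<Sum>n. ennreal (real m * ln (1 + c (\<lambda>n. D n \<omega>) n / real m)))) \<partial>M)"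
    by (intro nn_integral_cong) (simp add: F_def q nn_integral_cmult fading_laplace[OF c0])
  also have "\<dots> = (\<integral>\<^sup>+\<omega>. f0 (cnt {-1<..a} \<omega>) * f1 (cnt {a<..b} \<omega>)
      * ennreal (exp_neg (\<Sum>n. ennreal (real m * ln (1 + s * w (D n \<omega>) / real m)) * indicator {b<..} (D n \<omega>))) \<partial>M)"
    by (intro nn_integral_cong arg_cong2[where f = "(*)"] refl arg_cong[where f = ennreal]
        arg_cong[where f = exp_neg] suminf_cong) (auto simp: c_def split: split_indicator)
  also have "\<dots> = (\<integral>\<^sup>+\<omega>. f0 (cnt {-1<..a} \<omega>) \<partial>M) * (\<integral>\<^sup>+\<omega>. f1 (cnt {a<..b} \<omega>) \<partial>M)
      * ennreal (exp_neg (\<integral>\<^sup>+t. ennreal (1 - exp_neg (ennreal (real m * ln (1 + s * w t / real m)))) * indicator {b<..} t \<partial>Lam))"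
    by (rule laplace_functional[OF _ ab f]) measurable
  also have "(\<lambda>t. exp_neg (ennreal (real m * ln (1 + s * w t / real m)))) = (\<lambda>t. (real m / (real m + s * w t)) ^ m)"
    using m_pos s w_pos by (intro ext exp_neg_erlang_exponent) (auto simp: less_imp_le)
  finally show ?thesis
    by (simp add: laplace_def)
qed

lemma interf_laplace:
  assumes "0 \<le> s"
  shows "(\<integral>\<^sup>+\<omega>. ennreal (exp_neg (ennreal s * interf r \<omega>)) \<partial>M) = ennreal (laplace s r)"
  using count_interf_laplace[of r r "\<lambda>_. 1" "\<lambda>_. 1" s] assms by (simp add: emeasure_space_1)

end

section \<open>Joint law of the serving distance and the interference\<close>

lemma exp_minus_diff_le: "0 \<le> x \<Longrightarrow> x \<le> y \<Longrightarrow> exp (- x) - exp (- y) \<le> y - (x::real)"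
proof -
  assume xy: "0 \<le> x" "x \<le> y"
  have le: "1 - exp (- (y - x)) \<le> y - x"
    using exp_ge_add_one_self[of "- (y - x)"] by linarith
  have "exp (- x) - exp (- y) = exp (- x) * (1 - exp (- (y - x)))"
    by (simp add: algebra_simps exp_add[symmetric])
  also have "\<dots> \<le> 1 * (y - x)"
    using xy by (intro mult_mono le) auto
  finally show ?thesis by simp
qed

context fading_network
begin

lemma measure_Lam_Ioc: "a \<le> b \<Longrightarrow> measure Lam {a<..b} = V b - V a"
  using emeasure_intensity_Ioc[of lam h a b] lam_pos h_pos mono_cum_intensity[of lam h]
  by (simp add: measure_def monoD)

lemma measure_Lam_Ioc': "measure Lam {-1<..a} = V a"
  using h_pos by (cases "-1 \<le> a") (auto simp: measure_Lam_Ioc cum_intensity_def)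

lemma nn_integral_cnt_eq:
  assumes B: "B \<in> sets borel" "bounded B"
  shows "(\<integral>\<^sup>+\<omega>. of_bool (cnt B \<omega> = k) \<partial>M) = ennreal (measure Lam B ^ k / fact k * exp (- measure Lam B))"
proof -
  note [measurable] = cnt_measurable[OF B]
  have "(\<integral>\<^sup>+\<omega>. of_bool (cnt B \<omega> = k) \<partial>M) = (\<integral>\<^sup>+\<omega>. indicator {\<omega>\<in>space M. cnt B \<omega> = k} \<omega> \<partial>M)"
    by (intro nn_integral_cong) (auto split: split_indicator)
  also have "\<dots> = emeasure M {\<omega>\<in>space M. cnt B \<omega> = k}"
    by (rule nn_integral_indicator) measurable
  finally show ?thesis
    using count_poisson[OF B, of k] by (simp add: emeasure_eq_measure cnt_def)
qed

lemma nn_integral_cnt_ge2: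
  assumes B: "B \<in> sets borel" "bounded B"
  shows "(\<integral>\<^sup>+\<omega>. of_bool (2 \<le> cnt B \<omega>) \<partial>M) \<le> ennreal ((measure Lam B)\<^sup>2)"
proof -
  note [measurable] = cnt_measurable[OF B]
  define d where "d = measure Lam B"
  have d: "0 \<le> d" by (simp add: d_def)
  define p where "p = (\<integral>\<^sup>+\<omega>. of_bool (2 \<le> cnt B \<omega>) \<partial>M)"
  have "1 = (\<integral>\<^sup>+\<omega>. of_bool (2 \<le> cnt B \<omega>) + of_bool (cnt B \<omega> = 0) + of_bool (cnt B \<omega> = 1) \<partial>M)"
  proof -
    have "(\<integral>\<^sup>+\<omega>. of_bool (2 \<le> cnt B \<omega>) + of_bool (cnt B \<omega> = 0) + of_bool (cnt B \<omega> = 1) \<partial>M) = (\<integral>\<^sup>+\<omega>. 1 \<partial>M)"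
      by (intro nn_integral_cong) (auto simp: of_bool_def)
    then show ?thesis by (simp add: emeasure_space_1)
  qed
  also have "\<dots> = p + (\<integral>\<^sup>+\<omega>. of_bool (cnt B \<omega> = 0) \<partial>M) + (\<integral>\<^sup>+\<omega>. of_bool (cnt B \<omega> = 1) \<partial>M)"
    by (simp add: nn_integral_add p_def)
  also have "\<dots> = p + ennreal (exp (- d) + d * exp (- d))"
    using d by (simp add: nn_integral_cnt_eq[OF B] d_def[symmetric] add.assoc)
  finally have eq: "1 = p + ennreal (exp (- d) + d * exp (- d))" .
  then obtain p' where p': "p = ennreal p'" "0 \<le> p'"
    by (cases p) (auto simp: )
  from eq have "1 = p' + (exp (- d) + d * exp (- d))"
    using p' d by (simp add: ennreal_plus[symmetric] ennreal_1[symmetric] del: ennreal_plus ennreal_1)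
  moreover have "1 - d\<^sup>2 \<le> exp (- d) + d * exp (- d)"
  proof -
    have "(1 - d) * (1 + d) \<le> exp (- d) * (1 + d)"
      using d exp_ge_add_one_self[of "- d"] by (intro mult_right_mono) auto
    then show ?thesis by (simp add: algebra_simps power2_eq_square)
  qed
  ultimately have "p' \<le> d\<^sup>2" by linarith
  then show ?thesis using p' by (simp add: p_def d_def ennreal_leI)
qed

end

context fading_link
begin

definition nearest :: "nat \<Rightarrow> 'a \<Rightarrow> bool" where
  "nearest n \<omega> \<longleftrightarrow> (\<forall>k. k \<noteq> n \<longrightarrow> D n \<omega> < D k \<omega>)"

definition others :: "nat \<Rightarrow> 'a \<Rightarrow> ennreal" where
  "others n \<omega> = (\<Sum>k. if k = n then 0 else ennreal (w (D k \<omega>) * g k \<omega>))"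

lemma nearest_measurable [measurable]: "Measurable.pred M (nearest n)"
  unfolding nearest_def[abs_def] by measurable

lemma others_measurable [measurable]: "others n \<in> borel_measurable M"
  unfolding others_def[abs_def] by measurable

lemma nearest_unique: "nearest n \<omega> \<Longrightarrow> nearest k \<omega> \<Longrightarrow> n = k"
  unfolding nearest_def by (metis less_asym)

lemma suminf_nearest:
  assumes "nearest n \<omega>"
  shows "(\<Sum>k. of_bool (nearest k \<omega>) * f k) = (f n :: ennreal)"
proof -
  have "(\<Sum>k. of_bool (nearest k \<omega>) * f k) = (\<Sum>k\<in>{n}. of_bool (nearest k \<omega>) * f k)"
    by (rule suminf_finite) (use nearest_unique[OF assms] in auto)
  then show ?thesis using assms by simp
qed

lemma nearest_interval_bounds:
  fixes a b s :: real and \<omega> :: 'a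
  defines "q \<equiv> (\<Sum>n. of_bool (nearest n \<omega>) * (indicator {a<..b} (D n \<omega>) * ennreal (exp_neg (ennreal s * others n \<omega>))))"
  defines "one \<equiv> of_bool (cnt {-1<..a} \<omega> = 0) * of_bool (cnt {a<..b} \<omega> = 1) * ennreal (exp_neg (ennreal s * interf b \<omega>))"
  assumes ab: "a \<le> b" and fin: "finite {n. D n \<omega> \<in> {-1<..b}}"
  shows "one \<le> q" "q \<le> one + of_bool (cnt {-1<..a} \<omega> = 0) * of_bool (2 \<le> cnt {a<..b} \<omega>)"
proof -
  have D0: "-1 < D n \<omega>" "0 < D n \<omega>" for n using D_ge[of n \<omega>] h_pos by auto
  have fa: "finite {n. D n \<omega> \<in> {-1<..a}}" by (rule finite_subset[OF _ fin]) (use ab in auto)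
  have fb: "finite {n. D n \<omega> \<in> {a<..b}}" by (rule finite_subset[OF _ fin]) (use D0 in auto)
  have c0: "cnt {-1<..a} \<omega> = 0 \<longleftrightarrow> (\<forall>n. a < D n \<omega>)"
    using fa D0 by (auto simp: cnt_def not_le)
  have case1: "q = one" if A: "cnt {-1<..a} \<omega> = 0" "cnt {a<..b} \<omega> = 1"
  proof -
    obtain n where n: "{n. D n \<omega> \<in> {a<..b}} = {n}"
      using A(2) by (auto simp: cnt_def card_1_singleton_iff)
    then have Dn: "a < D n \<omega>" "D n \<omega> \<le> b" by auto
    have Dk: "b < D k \<omega>" if "k \<noteq> n" for k
    proof -
      have "k \<notin> {n. D n \<omega> \<in> {a<..b}}" using n that by simp
      moreover have "a < D k \<omega>" using A(1) c0 by simp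
      ultimately show ?thesis by auto
    qed
    have near: "nearest n \<omega>"
      using Dn Dk by (auto simp: nearest_def intro: le_less_trans)
    have "others n \<omega> = interf b \<omega>"
      unfolding others_def interf_def using Dn Dk
      by (intro suminf_cong) (auto split: split_indicator)
    then show ?thesis
      unfolding q_def one_def using A Dn by (simp add: suminf_nearest[OF near])
  qed
  have q0: "q = 0" if "\<And>n. nearest n \<omega> \<Longrightarrow> D n \<omega> \<notin> {a<..b}"
  proof -
    have "q = (\<Sum>n. 0)" unfolding q_def using that
      by (intro suminf_cong) (auto simp: of_bool_def split: split_indicator)
    then show ?thesis by simp
  qed
  have case2: "q \<le> of_bool (cnt {-1<..a} \<omega> = 0) * of_bool (2 \<le> cnt {a<..b} \<omega>)"
    if A: "\<not> (cnt {-1<..a} \<omega> = 0 \<and> cnt {a<..b} \<omega> = 1)"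
  proof (cases "\<exists>n. nearest n \<omega> \<and> D n \<omega> \<in> {a<..b}")
    case True
    then obtain n where n: "nearest n \<omega>" "D n \<omega> \<in> {a<..b}" by blast
    have "a < D k \<omega>" for k
      using n by (cases "k = n") (auto simp: nearest_def intro: less_trans)
    then have z: "cnt {-1<..a} \<omega> = 0" using c0 by simp
    have "cnt {a<..b} \<omega> \<noteq> 0"
      using fb n(2) by (auto simp: cnt_def)
    then have t: "2 \<le> cnt {a<..b} \<omega>" using A z by linarith
    show ?thesis
      unfolding q_def suminf_nearest[OF n(1)] using z t by (simp split: split_indicator)
  next
    case False
    then have "q = 0" by (intro q0) auto
    then show ?thesis by simp
  qed
  have one0: "one = 0" if "\<not> (cnt {-1<..a} \<omega> = 0 \<and> cnt {a<..b} \<omega> = 1)"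
    using that by (auto simp: one_def)
  show "one \<le> q" using case1 one0 by (cases "cnt {-1<..a} \<omega> = 0 \<and> cnt {a<..b} \<omega> = 1") auto
  show "q \<le> one + of_bool (cnt {-1<..a} \<omega> = 0) * of_bool (2 \<le> cnt {a<..b} \<omega>)"
    using case1 case2 one0 by (cases "cnt {-1<..a} \<omega> = 0 \<and> cnt {a<..b} \<omega> = 1") auto
qed

text \<open>
  At most one index is nearest, so integrating against this measure on pairs evaluates a function at the
  serving index without having to choose it.
\<close>

definition near_measure :: "('a \<times> nat) measure" where
  "near_measure = density (M \<Otimes>\<^sub>M count_space UNIV) (\<lambda>(\<omega>, n). of_bool (nearest n \<omega>))"

lemma nearest_measurable_pair [measurable]:
  "Measurable.pred (M \<Otimes>\<^sub>M count_space UNIV) (\<lambda>p. nearest (snd p) (fst p))"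
  by (rule measurable_compose_countable'[where I = UNIV and g = snd]) auto

lemma others_measurable_pair [measurable]:
  "(\<lambda>p. others (snd p) (fst p)) \<in> borel_measurable (M \<Otimes>\<^sub>M count_space UNIV)"
  by (rule measurable_compose_countable'[where I = UNIV and g = snd]) auto

lemma D_measurable_pair [measurable]:
  "(\<lambda>p. D (snd p) (fst p)) \<in> borel_measurable (M \<Otimes>\<^sub>M count_space UNIV)"
  by (rule measurable_compose_countable'[where I = UNIV and g = snd]) auto

lemma sets_near_measure [measurable_cong, simp]: "sets near_measure = sets (M \<Otimes>\<^sub>M count_space UNIV)"
  by (simp add: near_measure_def)

lemma nn_integral_near_measure:
  assumes [measurable]: "f \<in> borel_measurable (M \<Otimes>\<^sub>M count_space UNIV)"
  shows "(\<integral>\<^sup>+p. f p \<partial>near_measure) = (\<integral>\<^sup>+\<omega>. (\<Sum>n. of_bool (nearest n \<omega>) * f (\<omega>, n)) \<partial>M)"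
proof -
  interpret C: sigma_finite_measure "count_space (UNIV :: nat set)"
    by (rule sigma_finite_measure_count_space)
  have "(\<integral>\<^sup>+p. f p \<partial>near_measure) = (\<integral>\<^sup>+p. of_bool (nearest (snd p) (fst p)) * f p \<partial>(M \<Otimes>\<^sub>M count_space UNIV))"
    unfolding near_measure_def by (subst nn_integral_density) (auto simp: case_prod_beta)
  also have "\<dots> = (\<integral>\<^sup>+\<omega>. \<integral>\<^sup>+n. of_bool (nearest n \<omega>) * f (\<omega>, n) \<partial>count_space UNIV \<partial>M)"
    by (subst C.nn_integral_fst[symmetric]) auto
  also have "\<dots> = (\<integral>\<^sup>+\<omega>. (\<Sum>n. of_bool (nearest n \<omega>) * f (\<omega>, n)) \<partial>M)"
    by (simp add: nn_integral_count_space_nat)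
  finally show ?thesis .
qed

definition serving_measure :: "real \<Rightarrow> real measure" where
  "serving_measure s = distr (density near_measure (\<lambda>p. ennreal (exp_neg (ennreal s * others (snd p) (fst p)))))
     borel (\<lambda>p. D (snd p) (fst p))"

lemma emeasure_serving_measure:
  assumes [measurable]: "A \<in> sets borel"
  shows "emeasure (serving_measure s) A = (\<integral>\<^sup>+\<omega>. (\<Sum>n. of_bool (nearest n \<omega>) *
     (indicator A (D n \<omega>) * ennreal (exp_neg (ennreal s * others n \<omega>)))) \<partial>M)"
proof -
  have "emeasure (serving_measure s) A = (\<integral>\<^sup>+x. indicator A x \<partial>serving_measure s)"
    by (rule nn_integral_indicator[symmetric]) (simp add: serving_measure_def)
  also have "\<dots> = (\<integral>\<^sup>+p. ennreal (exp_neg (ennreal s * others (snd p) (fst p))) * indicator A (D (snd p) (fst p)) \<partial>near_measure)"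
    unfolding serving_measure_def
    by (subst nn_integral_distr) (auto simp: nn_integral_density)
  also have "\<dots> = (\<integral>\<^sup>+\<omega>. (\<Sum>n. of_bool (nearest n \<omega>) *
     (indicator A (D n \<omega>) * ennreal (exp_neg (ennreal s * others n \<omega>)))) \<partial>M)"
    by (subst nn_integral_near_measure) (auto simp: mult_ac)
  finally show ?thesis .
qed

lemma laplace_mono: 
  assumes "0 \<le> s" "x \<le> y" shows "laplace s x \<le> laplace s y"
proof -
  have "(\<integral>\<^sup>+t. ennreal (1 - (real m / (real m + s * w t)) ^ m) * indicator {y<..} t \<partial>Lam)
      \<le> (\<integral>\<^sup>+t. ennreal (1 - (real m / (real m + s * w t)) ^ m) * indicator {x<..} t \<partial>Lam)"
    using assms by (intro nn_integral_mono mult_left_mono) (auto split: split_indicator)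
  then show ?thesis unfolding laplace_def by (rule exp_neg_antimono)
qed

lemma laplace_bounds: "0 \<le> laplace s x" "laplace s x \<le> 1"
  by (simp_all add: laplace_def)

lemma laplace_0: "laplace 0 x = 1"
  using m_pos by (simp add: laplace_def)

lemma laplace_measurable [measurable]:
  assumes "0 \<le> s" shows "laplace s \<in> borel_measurable borel"
  by (intro borel_measurable_mono monoI laplace_mono assms)

lemma serving_measure_Ioc_bounds:
  assumes ab: "a \<le> b" and s: "0 \<le> s"
  shows "ennreal ((V b - V a) * exp (- V b) * laplace s b) \<le> emeasure (serving_measure s) {a<..b}"
    and "emeasure (serving_measure s) {a<..b} \<le> ennreal ((V b - V a) * exp (- V b) * laplace s b + (V b - V a)\<^sup>2)"
proof -
  let ?d = "V b - V a"
  have d: "0 \<le> ?d" using mono_cum_intensity[of lam h] lam_pos h_pos ab by (simp add: monoD)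
  note [measurable] = cnt_measurable[of "{-1<..a}", simplified] cnt_measurable[of "{a<..b}", simplified]
  let ?one = "\<lambda>\<omega>. of_bool (cnt {-1<..a} \<omega> = 0) * of_bool (cnt {a<..b} \<omega> = 1) * ennreal (exp_neg (ennreal s * interf b \<omega>))"
  let ?two = "\<lambda>\<omega>. of_bool (cnt {-1<..a} \<omega> = 0) * of_bool (2 \<le> cnt {a<..b} \<omega>) :: ennreal"
  have fin: "AE \<omega> in M. finite {n. D n \<omega> \<in> {-1<..b}}"
    by (rule finite_points) auto
  have p0: "(\<integral>\<^sup>+\<omega>. of_bool (cnt {-1<..a} \<omega> = 0) \<partial>M) = ennreal (exp (- V a))"
    using nn_integral_cnt_eq[of "{-1<..a}" 0] by (simp add: measure_Lam_Ioc')
  have p1: "(\<integral>\<^sup>+\<omega>. of_bool (cnt {a<..b} \<omega> = 1) \<partial>M) = ennreal (?d * exp (- ?d))"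
    using nn_integral_cnt_eq[of "{a<..b}" 1] ab by (simp add: measure_Lam_Ioc)
  have "(\<integral>\<^sup>+\<omega>. ?one \<omega> \<partial>M) = ennreal (exp (- V a)) * ennreal (?d * exp (- ?d)) * ennreal (laplace s b)"
    unfolding p0[symmetric] p1[symmetric]
    by (rule count_interf_laplace[OF ab _ _ s, where ?f0.0 = "\<lambda>k. of_bool (k = 0)" and ?f1.0 = "\<lambda>k. of_bool (k = 1)"])
       (auto simp: of_bool_def)
  also have "\<dots> = ennreal (exp (- V a) * (?d * exp (- ?d)) * laplace s b)"
    using d by (simp add: ennreal_mult'[symmetric] laplace_bounds)
  also have "exp (- V a) * (?d * exp (- ?d)) = ?d * exp (- V b)"
    by (simp add: mult.left_commute exp_add[symmetric])
  finally have one: "(\<integral>\<^sup>+\<omega>. ?one \<omega> \<partial>M) = ennreal (?d * exp (- V b) * laplace s b)" .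
  have "(\<integral>\<^sup>+\<omega>. ?two \<omega> \<partial>M) = (\<integral>\<^sup>+\<omega>. of_bool (cnt {-1<..a} \<omega> = 0) \<partial>M) * (\<integral>\<^sup>+\<omega>. of_bool (2 \<le> cnt {a<..b} \<omega>) \<partial>M)"
    using count_interf_laplace[OF ab, of "\<lambda>k. of_bool (k = 0)" "\<lambda>k. of_bool (2 \<le> k)" 0]
    by (simp add: laplace_0)
  also have "\<dots> \<le> 1 * ennreal (?d\<^sup>2)"
    using nn_integral_cnt_ge2[of "{a<..b}"] ab cum_intensity_nonneg[of lam h a] lam_pos h_pos
    by (intro mult_mono) (auto simp: p0 measure_Lam_Ioc)
  finally have two: "(\<integral>\<^sup>+\<omega>. ?two \<omega> \<partial>M) \<le> ennreal (?d\<^sup>2)" by simp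
  show "ennreal (?d * exp (- V b) * laplace s b) \<le> emeasure (serving_measure s) {a<..b}"
    unfolding one[symmetric] emeasure_serving_measure[of "{a<..b}", simplified]
  proof (rule nn_integral_mono_AE)
    show "AE \<omega> in M. ?one \<omega> \<le> (\<Sum>n. of_bool (nearest n \<omega>) * (indicator {a<..b} (D n \<omega>) * ennreal (exp_neg (ennreal s * others n \<omega>))))"
      using fin by eventually_elim (rule nearest_interval_bounds(1)[OF ab])
  qed
  have "emeasure (serving_measure s) {a<..b} \<le> (\<integral>\<^sup>+\<omega>. ?one \<omega> + ?two \<omega> \<partial>M)"
    unfolding emeasure_serving_measure[of "{a<..b}", simplified]
  proof (rule nn_integral_mono_AE)
    show "AE \<omega> in M. (\<Sum>n. of_bool (nearest n \<omega>) * (indicator {a<..b} (D n \<omega>) * ennreal (exp_neg (ennreal s * others n \<omega>)))) \<le> ?one \<omega> + ?two \<omega>"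
      using fin by eventually_elim (rule nearest_interval_bounds(2)[OF ab])
  qed
  also have "\<dots> = (\<integral>\<^sup>+\<omega>. ?one \<omega> \<partial>M) + (\<integral>\<^sup>+\<omega>. ?two \<omega> \<partial>M)"
    by (rule nn_integral_add) measurable
  also have "\<dots> \<le> ennreal (?d * exp (- V b) * laplace s b) + ennreal (?d\<^sup>2)"
    unfolding one by (intro add_left_mono two)
  also have "\<dots> = ennreal (?d * exp (- V b) * laplace s b + ?d\<^sup>2)"
    using d by (intro ennreal_plus[symmetric]) (auto simp: laplace_bounds)
  finally show "emeasure (serving_measure s) {a<..b} \<le> ennreal (?d * exp (- V b) * laplace s b + ?d\<^sup>2)" .
qed

definition serving_density_measure :: "real \<Rightarrow> real measure" where
  "serving_density_measure s = density Lam (\<lambda>r. ennreal (exp (- V r) * laplace s r))"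

lemma serving_density_measure_Ioc_bounds:
  assumes ab: "a \<le> b" and s: "0 \<le> s"
  shows "ennreal ((V b - V a) * exp (- V b) * laplace s a) \<le> emeasure (serving_density_measure s) {a<..b}"
    and "emeasure (serving_density_measure s) {a<..b} \<le> ennreal ((V b - V a) * exp (- V a) * laplace s b)"
proof -
  let ?d = "V b - V a"
  note mV = monoD[OF mono_cum_intensity[of lam h]]
  have d: "0 \<le> ?d" using mV lam_pos h_pos ab by simp
  note [measurable] = laplace_measurable[OF s]
  have eq: "emeasure (serving_density_measure s) {a<..b}
      = (\<integral>\<^sup>+r. ennreal (exp (- V r) * laplace s r) * indicator {a<..b} r \<partial>Lam)"
    unfolding serving_density_measure_def by (subst emeasure_density) auto
  have const: "(\<integral>\<^sup>+r. ennreal c * indicator {a<..b} r \<partial>Lam) = ennreal (?d * c)" if "0 \<le> c" for c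
    using lam_pos h_pos ab d that
    by (subst nn_integral_cmult_indicator) (auto simp: emeasure_intensity_Ioc ennreal_mult'[symmetric] mult.commute)
  have "ennreal (?d * exp (- V b) * laplace s a) = (\<integral>\<^sup>+r. ennreal (exp (- V b) * laplace s a) * indicator {a<..b} r \<partial>Lam)"
    by (subst const) (auto simp: laplace_bounds mult.assoc)
  also have "\<dots> \<le> emeasure (serving_density_measure s) {a<..b}"
    unfolding eq using s lam_pos h_pos
    by (intro nn_integral_mono) (auto split: split_indicator simp: laplace_bounds intro!: ennreal_leI mult_mono mV laplace_mono)
  finally show "ennreal (?d * exp (- V b) * laplace s a) \<le> emeasure (serving_density_measure s) {a<..b}" .
  have "emeasure (serving_density_measure s) {a<..b} \<le> (\<integral>\<^sup>+r. ennreal (exp (- V a) * laplace s b) * indicator {a<..b} r \<partial>Lam)"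
    unfolding eq using s lam_pos h_pos
    by (intro nn_integral_mono) (auto split: split_indicator simp: laplace_bounds intro!: ennreal_leI mult_mono mV laplace_mono)
  also have "\<dots> = ennreal (?d * exp (- V a) * laplace s b)"
    by (subst const) (auto simp: laplace_bounds mult.assoc)
  finally show "emeasure (serving_density_measure s) {a<..b} \<le> ennreal (?d * exp (- V a) * laplace s b)" .
qed

lemma serving_measure_eq:
  assumes s: "0 \<le> s"
  shows "serving_measure s = serving_density_measure s"
proof (rule measure_eqI_Ioc)
  let ?m = "serving_measure s" and ?n = "serving_density_measure s"
  show sets: "sets ?m = sets borel" "sets ?n = sets borel"
    by (simp_all add: serving_measure_def serving_density_measure_def)
  have fm: "emeasure ?m {x<..y} \<noteq> \<infinity>" if "x \<le> y" for x y
    using serving_measure_Ioc_bounds(2)[OF that s] by (auto simp: top_unique)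
  have fn: "emeasure ?n {x<..y} \<noteq> \<infinity>" if "x \<le> y" for x y
    using serving_density_measure_Ioc_bounds(2)[OF that s] by (auto simp: top_unique)
  show "emeasure ?m {a<..b} \<noteq> \<infinity>" if "a \<le> b" for a b by (rule fm[OF that])
  fix a b :: real assume ab: "a \<le> b"
  define f where "f x = measure ?m {a<..x} - measure ?n {a<..x}" for x
  note mV = monoD[OF mono_cum_intensity[of lam h]]
  have "f b = f a"
  proof (rule eq_if_increment_bound[OF ab, where M = "\<lambda>x. laplace s x + V x" and C = "2 * pi * lam * \<bar>b\<bar>"])
    fix x y assume xy: "a \<le> x" "x \<le> y" "y \<le> b"
    let ?d = "V y - V x"
    have d: "0 \<le> ?d" using mV lam_pos h_pos xy by simp
    have add: "measure N {a<..y} = measure N {a<..x} + measure N {x<..y}"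
      if "sets N = sets borel" "\<And>x y. x \<le> y \<Longrightarrow> emeasure N {x<..y} \<noteq> \<infinity>" for N
    proof -
      have "{a<..y} = {a<..x} \<union> {x<..y}" using xy by auto
      then show ?thesis
        using measure_Union[of N "{a<..x}" "{x<..y}"] that xy by auto
    qed
    have feq: "f y - f x = measure ?m {x<..y} - measure ?n {x<..y}"
      using add[OF sets(1) fm] add[OF sets(2) fn] by (simp add: f_def)
    have real: "c \<le> measure N A" if "ennreal c \<le> emeasure N A" "emeasure N A \<noteq> \<infinity>" for c :: real and N :: "real measure" and A
      using that by (simp add: emeasure_eq_ennreal_measure top_unique)
    have real': "measure N A \<le> c" if "emeasure N A \<le> ennreal c" "0 \<le> c" for c :: real and N :: "real measure" and A
      using that enn2real_mono[OF that(1)] by (simp add: measure_def)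
    have m1: "?d * exp (- V y) * laplace s y \<le> measure ?m {x<..y}"
      using serving_measure_Ioc_bounds(1)[OF xy(2) s] fm[OF xy(2)] by (rule real)
    have m2: "measure ?m {x<..y} \<le> ?d * exp (- V y) * laplace s y + ?d\<^sup>2"
      using serving_measure_Ioc_bounds(2)[OF xy(2) s] d by (intro real') (auto simp: laplace_bounds)
    have n1: "?d * exp (- V y) * laplace s x \<le> measure ?n {x<..y}"
      using serving_density_measure_Ioc_bounds(1)[OF xy(2) s] fn[OF xy(2)] by (rule real)
    have n2: "measure ?n {x<..y} \<le> ?d * exp (- V x) * laplace s y"
      using serving_density_measure_Ioc_bounds(2)[OF xy(2) s] d by (intro real') (auto simp: laplace_bounds)
    have Vx: "0 \<le> V x" "0 \<le> V y" using cum_intensity_nonneg lam_pos h_pos by simp_all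
    have L: "0 \<le> laplace s y - laplace s x" using laplace_mono[OF s xy(2)] by simp
    have "exp (- V y) * (laplace s y - laplace s x) \<le> 1 * (laplace s y - laplace s x)"
      using Vx L by (intro mult_right_mono) auto
    then have A: "?d * (exp (- V y) * (laplace s y - laplace s x)) \<le> ?d * (laplace s y - laplace s x)"
      using d by (intro mult_left_mono) auto
    have "(exp (- V x) - exp (- V y)) * laplace s y \<le> ?d * 1"
      using exp_minus_diff_le[OF Vx(1)] d Vx xy by (intro mult_mono) (auto simp: laplace_bounds)
    then have B: "?d * ((exp (- V x) - exp (- V y)) * laplace s y) \<le> ?d * ?d"
      using d by (intro mult_left_mono) auto
    have C: "0 \<le> ?d * (laplace s y - laplace s x)" using d L by simp
    have "\<bar>f y - f x\<bar> \<le> ?d * (laplace s y - laplace s x + ?d)"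
      unfolding feq using m1 m2 n1 n2 A B C
      by (simp add: algebra_simps power2_eq_square abs_le_iff)
    also have "\<dots> \<le> (2 * pi * lam * \<bar>b\<bar> * (y - x)) * (laplace s y - laplace s x + ?d)"
      using cum_intensity_lipschitz[of lam h x y b] lam_pos h_pos xy d L by (intro mult_right_mono) auto
    finally show "\<bar>f y - f x\<bar> \<le> 2 * pi * lam * \<bar>b\<bar> * (y - x) * (laplace s y + V y - (laplace s x + V x))"
      by (simp add: algebra_simps)
  qed
  then have "measure ?m {a<..b} = measure ?n {a<..b}" by (simp add: f_def)
  then show "emeasure ?m {a<..b} = emeasure ?n {a<..b}"
    using fm[OF ab] fn[OF ab] by (simp add: emeasure_eq_ennreal_measure)
qed

end

lemma nn_integral_eq_of_mixed_moments:
  fixes \<mu> \<nu> :: "(real \<times> real) measure" and F :: "real \<times> real \<Rightarrow> real"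
  assumes "finite_measure \<mu>" "finite_measure \<nu>"
    and sets [measurable_cong]: "sets \<mu> = sets (borel \<Otimes>\<^sub>M borel)" "sets \<nu> = sets (borel \<Otimes>\<^sub>M borel)"
    and unit: "AE p in \<mu>. snd p \<in> {0..1}" "AE p in \<nu>. snd p \<in> {0..1}"
    and moments: "\<And>A k. A \<in> sets borel \<Longrightarrow>
      (\<integral>\<^sup>+p. indicator A (fst p) * ennreal (snd p ^ k) \<partial>\<mu>) = (\<integral>\<^sup>+p. indicator A (fst p) * ennreal (snd p ^ k) \<partial>\<nu>)"
    and F [measurable]: "F \<in> borel_measurable (borel \<Otimes>\<^sub>M borel)"
    and F_bounds: "\<And>r y. y \<in> {0..1} \<Longrightarrow> 0 \<le> F (r, y) \<and> F (r, y) \<le> 1"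
    and F_cont: "\<And>r. continuous_on {0..1} (\<lambda>y. F (r, y))"
  shows "(\<integral>\<^sup>+p. ennreal (F p) \<partial>\<mu>) = (\<integral>\<^sup>+p. ennreal (F p) \<partial>\<nu>)"
proof -
  interpret \<mu>: finite_measure \<mu> by fact
  interpret \<nu>: finite_measure \<nu> by fact
  have moment_fn: "(\<integral>\<^sup>+p. a (fst p) * ennreal (snd p ^ k) \<partial>\<mu>) = (\<integral>\<^sup>+p. a (fst p) * ennreal (snd p ^ k) \<partial>\<nu>)"
    if a [measurable]: "a \<in> borel_measurable borel" for a :: "real \<Rightarrow> ennreal" and k
  proof -
    define K where "K N = distr (density N (\<lambda>p. ennreal (snd p ^ k))) borel fst" for N :: "(real \<times> real) measure"
    have K: "(\<integral>\<^sup>+r. b r \<partial>K N) = (\<integral>\<^sup>+p. b (fst p) * ennreal (snd p ^ k) \<partial>N)"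
      if [measurable_cong]: "sets N = sets (borel \<Otimes>\<^sub>M borel)" and [measurable]: "b \<in> borel_measurable borel" for b N
      unfolding K_def by (subst nn_integral_distr) (auto simp: nn_integral_density mult.commute)
    have "K \<mu> = K \<nu>"
    proof (rule measure_eqI)
      fix A assume "A \<in> sets (K \<mu>)"
      then have A [measurable]: "A \<in> sets borel" by (simp add: K_def)
      then have "emeasure (K N) A = (\<integral>\<^sup>+r. indicator A r \<partial>K N)" for N
        by (intro nn_integral_indicator[symmetric]) (simp add: K_def)
      then show "emeasure (K \<mu>) A = emeasure (K \<nu>) A"
        using moments[OF A] K[OF sets(1)] K[OF sets(2)] by simp
    qed (simp add: K_def)
    then show ?thesis using K[OF sets(1) a] K[OF sets(2) a] by simp
  qed
  have moment_int: "(\<integral>p. a (fst p) * snd p ^ k \<partial>\<mu>) = (\<integral>p. a (fst p) * snd p ^ k \<partial>\<nu>)"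
    and moment_itg: "integrable \<mu> (\<lambda>p. a (fst p) * snd p ^ k)" "integrable \<nu> (\<lambda>p. a (fst p) * snd p ^ k)"
    if a [measurable]: "a \<in> borel_measurable borel" and b: "\<And>r. 0 \<le> a r \<and> a r \<le> 1" for a :: "real \<Rightarrow> real" and k
  proof -
    have nn: "AE p in N. 0 \<le> a (fst p) * snd p ^ k \<and> norm (a (fst p) * snd p ^ k) \<le> 1" if "AE p in N. snd p \<in> {0..1}" for N :: "(real \<times> real) measure"
      using that
    proof eventually_elim
      case (elim p)
      then have "a (fst p) * snd p ^ k \<le> 1 * 1"
        using b by (intro mult_mono power_le_one) auto
      then show ?case using b[of "fst p"] elim by (simp add: abs_mult)
    qed
    have eq: "(\<integral>p. a (fst p) * snd p ^ k \<partial>N) = enn2real (\<integral>\<^sup>+p. ennreal (a (fst p)) * ennreal (snd p ^ k) \<partial>N)"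
      if AE: "AE p in N. snd p \<in> {0..1}" and [measurable_cong]: "sets N = sets (borel \<Otimes>\<^sub>M borel)" for N
    proof -
      have "(\<integral>p. a (fst p) * snd p ^ k \<partial>N) = enn2real (\<integral>\<^sup>+p. ennreal (a (fst p) * snd p ^ k) \<partial>N)"
        using nn[OF AE] by (intro integral_eq_nn_integral) (auto elim: AE_mp)
      also have "(\<integral>\<^sup>+p. ennreal (a (fst p) * snd p ^ k) \<partial>N) = (\<integral>\<^sup>+p. ennreal (a (fst p)) * ennreal (snd p ^ k) \<partial>N)"
        using b by (intro nn_integral_cong) (simp add: ennreal_mult')
      finally show ?thesis .
    qed
    show "(\<integral>p. a (fst p) * snd p ^ k \<partial>\<mu>) = (\<integral>p. a (fst p) * snd p ^ k \<partial>\<nu>)"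
      unfolding eq[OF unit(1) sets(1)] eq[OF unit(2) sets(2)]
      by (subst moment_fn[of "\<lambda>r. ennreal (a r)"]) auto
    show "integrable \<mu> (\<lambda>p. a (fst p) * snd p ^ k)"
      using nn[OF unit(1)] by (intro \<mu>.integrable_const_bound[where B = 1]) (auto elim: AE_mp)
    show "integrable \<nu> (\<lambda>p. a (fst p) * snd p ^ k)"
      using nn[OF unit(2)] by (intro \<nu>.integrable_const_bound[where B = 1]) (auto elim: AE_mp)
  qed
  have bern_int: "(\<integral>p. a (fst p) * Bernstein n k (snd p) \<partial>\<mu>) = (\<integral>p. a (fst p) * Bernstein n k (snd p) \<partial>\<nu>)
      \<and> integrable \<mu> (\<lambda>p. a (fst p) * Bernstein n k (snd p)) \<and> integrable \<nu> (\<lambda>p. a (fst p) * Bernstein n k (snd p))"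
    if a [measurable]: "a \<in> borel_measurable borel" and b: "\<And>r. 0 \<le> a r \<and> a r \<le> 1" for a :: "real \<Rightarrow> real" and n k
  proof -
    define q where "q = smult (of_nat (n choose k)) ([:0, 1:] ^ k * [:1, -1:] ^ (n - k) :: real poly)"
    have "Bernstein n k y = poly q y" for y
      by (simp add: Bernstein_def q_def poly_power mult.assoc)
    then have "(\<lambda>p. a (fst p) * Bernstein n k (snd p))
        = (\<lambda>p. \<Sum>i\<le>degree q. coeff q i * (a (fst p) * snd p ^ i))"
      by (auto simp: poly_altdef sum_distrib_left mult_ac)
    then show ?thesis
      using moment_int[OF a b] moment_itg[OF a b] by simp
  qed
  define P where "P n p = (\<Sum>k\<le>n. F (fst p, real k / real n) * Bernstein n k (snd p))" for n p
  have frac: "real k / real n \<in> {0..1}" if "k \<le> n" for k n :: nat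
    using that by (auto simp: divide_le_eq)
  have Fk: "(\<lambda>r. F (r, c)) \<in> borel_measurable borel" for c by measurable
  have P_eq: "(\<integral>p. P n p \<partial>\<mu>) = (\<integral>p. P n p \<partial>\<nu>)" for n
  proof -
    have *: "(\<integral>p. F (fst p, real k / real n) * Bernstein n k (snd p) \<partial>\<mu>) = (\<integral>p. F (fst p, real k / real n) * Bernstein n k (snd p) \<partial>\<nu>)
      \<and> integrable \<mu> (\<lambda>p. F (fst p, real k / real n) * Bernstein n k (snd p)) \<and> integrable \<nu> (\<lambda>p. F (fst p, real k / real n) * Bernstein n k (snd p))"
      if "k \<le> n" for k
      using F_bounds[OF frac[OF that]] by (intro bern_int[of "\<lambda>r. F (r, real k / real n)"] Fk)
    have "(\<integral>p. P n p \<partial>\<mu>) = (\<Sum>k\<le>n. \<integral>p. F (fst p, real k / real n) * Bernstein n k (snd p) \<partial>\<mu>)"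
      unfolding P_def by (rule Bochner_Integration.integral_sum) (use * in auto)
    also have "\<dots> = (\<Sum>k\<le>n. \<integral>p. F (fst p, real k / real n) * Bernstein n k (snd p) \<partial>\<nu>)"
      using * by (intro sum.cong) auto
    also have "\<dots> = (\<integral>p. P n p \<partial>\<nu>)"
      unfolding P_def by (rule Bochner_Integration.integral_sum[symmetric]) (use * in auto)
    finally show ?thesis .
  qed
  have P_meas: "P n \<in> borel_measurable (borel \<Otimes>\<^sub>M borel)" for n
    unfolding P_def[abs_def] Bernstein_def by measurable
  have P_lim: "(\<lambda>n. P n p) \<longlonglongrightarrow> F p" if "snd p \<in> {0..1}" for p
  proof (rule LIMSEQ_I)
    fix e :: real assume "0 < e"
    from Bernstein_Weierstrass[OF F_cont[of "fst p"] this] obtain N where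
      N: "\<And>n x. N \<le> n \<Longrightarrow> x \<in> {0..1} \<Longrightarrow> \<bar>F (fst p, x) - (\<Sum>k\<le>n. F (fst p, real k / real n) * Bernstein n k x)\<bar> < e"
      by blast
    show "\<exists>N. \<forall>n\<ge>N. norm (P n p - F p) < e"
      using N[OF _ that] by (intro exI[of _ N]) (auto simp: P_def abs_minus_commute)
  qed
  have P_bound: "norm (P n p) \<le> 1" if "snd p \<in> {0..1}" for n p
  proof -
    have "0 \<le> P n p"
      unfolding P_def using F_bounds[OF frac] that by (intro sum_nonneg mult_nonneg_nonneg Bernstein_nonneg) auto
    moreover have "P n p \<le> (\<Sum>k\<le>n. 1 * Bernstein n k (snd p))"
      unfolding P_def using F_bounds[OF frac] that by (intro sum_mono mult_right_mono Bernstein_nonneg) auto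
    ultimately show ?thesis by simp
  qed
  have lim: "(\<lambda>n. \<integral>p. P n p \<partial>N) \<longlonglongrightarrow> (\<integral>p. F p \<partial>N)"
    if "finite_measure N" and [measurable_cong]: "sets N = sets (borel \<Otimes>\<^sub>M borel)" and u: "AE p in N. snd p \<in> {0..1}" for N
  proof (rule integral_dominated_convergence[where w = "\<lambda>_. 1"])
    interpret finite_measure N by fact
    show "integrable N (\<lambda>_. 1 :: real)" by simp
    show "AE p in N. (\<lambda>n. P n p) \<longlonglongrightarrow> F p" using u by eventually_elim (rule P_lim)
    show "AE p in N. norm (P n p) \<le> 1" for n using u by eventually_elim (rule P_bound)
    show "P n \<in> borel_measurable N" for n using P_meas[of n] by simp
    show "F \<in> borel_measurable N" by simp
  qed
  have "(\<integral>p. F p \<partial>\<mu>) = (\<integral>p. F p \<partial>\<nu>)"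
    using LIMSEQ_unique[OF lim[OF assms(1) sets(1) unit(1)], of "\<integral>p. F p \<partial>\<nu>"] lim[OF assms(2) sets(2) unit(2)]
    by (simp add: P_eq)
  moreover have "(\<integral>\<^sup>+p. ennreal (F p) \<partial>N) = ennreal (\<integral>p. F p \<partial>N)"
    if "finite_measure N" and [measurable_cong]: "sets N = sets (borel \<Otimes>\<^sub>M borel)" and u: "AE p in N. snd p \<in> {0..1}" for N
  proof (rule nn_integral_eq_integral)
    interpret finite_measure N by fact
    have *: "0 \<le> F p \<and> F p \<le> 1" if "snd p \<in> {0..1}" for p using F_bounds[of "snd p" "fst p"] that by simp
    show "AE p in N. 0 \<le> F p" using u by eventually_elim (use * in auto)
    show "integrable N F"
    proof (rule integrable_const_bound[where B = 1])
      show "AE p in N. norm (F p) \<le> 1" using u by eventually_elim (use * in auto)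
    qed simp
  qed
  ultimately show ?thesis
    using assms(1,2) sets unit by simp
qed

definition poisson_term :: "nat \<Rightarrow> ennreal \<Rightarrow> real" where
  "poisson_term k x = (if x = \<infinity> then 0 else enn2real x ^ k / fact k * exp (- enn2real x))"

lemma poisson_term_nonneg [simp]: "0 \<le> poisson_term k x"
  by (simp add: poisson_term_def)

lemma poisson_term_top [simp]: "poisson_term k top = 0"
  by (simp add: poisson_term_def)

lemma poisson_term_ennreal: "0 \<le> x \<Longrightarrow> poisson_term k (ennreal x) = x ^ k / fact k * exp (- x)"
  by (simp add: poisson_term_def)

lemma poisson_term_measurable [measurable]: "poisson_term k \<in> borel_measurable borel"
  unfolding poisson_term_def[abs_def] by measurable

lemma sum_poisson_term_le_1: "(\<Sum>k<m. poisson_term k x) \<le> 1"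
proof (cases x)
  case (real r)
  have "(\<Sum>k<m. r ^ k / fact k) = (\<Sum>k<m. r ^ k /\<^sub>R fact k)"
    by (simp add: divide_inverse mult.commute)
  also have "\<dots> \<le> (\<Sum>k. r ^ k /\<^sub>R fact k)"
    using real by (intro sum_le_suminf summable_exp_generic) auto
  also have "\<dots> = exp r" by (simp add: exp_def)
  finally have "(\<Sum>k<m. r ^ k / fact k) * exp (- r) \<le> exp r * exp (- r)"
    by (intro mult_right_mono) auto
  then show ?thesis
    using real by (simp add: poisson_term_ennreal sum_distrib_right exp_minus)
qed simp

lemma poisson_term_le_1: "poisson_term k x \<le> 1"
proof -
  have "poisson_term k x \<le> (\<Sum>i<Suc k. poisson_term i x)"
    by (rule member_le_sum) auto
  also have "\<dots> \<le> 1" by (rule sum_poisson_term_le_1)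
  finally show ?thesis .
qed

lemma tendsto_poisson_term:
  assumes "(f \<longlongrightarrow> x) F"
  shows "((\<lambda>n. poisson_term k (f n)) \<longlongrightarrow> poisson_term k x) F"
proof (cases "x = \<infinity>")
  case False
  then obtain r where r: "x = ennreal r" "0 \<le> r" by (cases x) auto
  have ev: "eventually (\<lambda>n. f n < \<infinity>) F"
    using order_tendstoD(2)[OF assms, of \<infinity>] r by simp
  have "((\<lambda>n. enn2real (f n) ^ k / fact k * exp (- enn2real (f n))) \<longlongrightarrow> r ^ k / fact k * exp (- r)) F"
    using assms r by (intro tendsto_intros tendsto_enn2real) auto
  moreover have "\<forall>\<^sub>F n in F. enn2real (f n) ^ k / fact k * exp (- enn2real (f n)) = poisson_term k (f n)"
    using ev by eventually_elim (auto simp: poisson_term_def)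
  ultimately have "((\<lambda>n. poisson_term k (f n)) \<longlongrightarrow> r ^ k / fact k * exp (- r)) F"
    by (rule Lim_transform_eventually)
  then show ?thesis
    using r by (simp add: poisson_term_ennreal)
next
  case True
  show ?thesis unfolding True
  proof (rule tendstoI)
    fix e :: real assume e: "0 < e"
    have "((\<lambda>x::real. x ^ k / exp x) \<longlongrightarrow> 0) at_top" by (rule tendsto_power_div_exp_0)
    from tendstoD[OF this e] obtain N where N: "\<And>x. N \<le> x \<Longrightarrow> \<bar>x ^ k / exp x\<bar> < e"
      by (auto simp: eventually_at_top_linorder)
    have "eventually (\<lambda>n. ennreal (max 0 N) < f n) F"
      using order_tendstoD(1)[OF assms, of "ennreal (max 0 N)"] True by simp
    then show "eventually (\<lambda>n. dist (poisson_term k (f n)) (poisson_term k \<infinity>) < e) F"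
    proof eventually_elim
      case (elim n)
      show ?case
      proof (cases "f n")
        case (real r)
        have "N \<le> r"
        proof (rule ccontr)
          assume "\<not> N \<le> r"
          then have "f n \<le> ennreal (max 0 N)" using real by (auto intro!: ennreal_leI)
          then show False using elim by simp
        qed
        have "r ^ k / fact k \<le> r ^ k / 1"
          using real fact_ge_1[of k] by (intro divide_left_mono) auto
        then have "r ^ k / fact k * exp (- r) \<le> r ^ k * exp (- r)"
          by (intro mult_right_mono) auto
        then have "poisson_term k (f n) \<le> r ^ k / exp r"
          using real by (simp add: poisson_term_ennreal exp_minus divide_inverse)
        also have "\<dots> < e" using N[OF \<open>N \<le> r\<close>] by linarith
        finally show ?thesis by simp
      qed (use e in simp)
    qed
  qed
qed

definition neg_ln :: "real \<Rightarrow> ennreal" where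
  "neg_ln y = (if y \<le> 0 then \<infinity> else ennreal (- ln y))"

lemma neg_ln_exp_neg [simp]: "neg_ln (exp_neg x) = x"
  by (cases x) (auto simp: neg_ln_def exp_neg_def)

lemma neg_ln_measurable [measurable]: "neg_ln \<in> borel_measurable borel"
  unfolding neg_ln_def[abs_def] by measurable

lemma continuous_on_neg_ln: "continuous_on {0..1} neg_ln"
  unfolding continuous_on
proof
  fix y :: real assume y: "y \<in> {0..1}"
  show "(neg_ln \<longlongrightarrow> neg_ln y) (at y within {0..1})"
  proof (cases "y = 0")
    case False
    then have "0 < y" using y by simp
    then have "((\<lambda>x. ennreal (- ln x)) \<longlongrightarrow> ennreal (- ln y)) (at y within {0..1})"
      by (intro tendsto_ennrealI tendsto_intros) auto
    moreover have "eventually (\<lambda>x. ennreal (- ln x) = neg_ln x) (at y within {0..1})"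
    proof -
      have "eventually (\<lambda>x. 0 < x) (at y within {0..1})"
        using \<open>0 < y\<close> order_tendstoD(1)[OF tendsto_ident_at, of 0 y "{0..1}"] by simp
      then show ?thesis by eventually_elim (simp add: neg_ln_def)
    qed
    ultimately have "(neg_ln \<longlongrightarrow> ennreal (- ln y)) (at y within {0..1})"
      by (rule Lim_transform_eventually)
    then show ?thesis using \<open>0 < y\<close> by (simp add: neg_ln_def)
  next
    case True
    have "(neg_ln \<longlongrightarrow> top) (at 0 within {0..1})"
    proof (rule order_tendstoI)
      fix a :: ennreal assume "a < top"
      then obtain r where r: "a = ennreal r" "0 \<le> r" by (cases a) auto
      have "eventually (\<lambda>x::real. x < exp (- r)) (at 0 within {0..1})"
        using order_tendstoD(2)[OF tendsto_ident_at, of 0 "exp (- r)"] by simp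
      then show "eventually (\<lambda>x. a < neg_ln x) (at 0 within {0..1})"
      proof eventually_elim
        case (elim x)
        show ?case
        proof (cases "x \<le> 0")
          case False
          then have "ln x < ln (exp (- r))" using elim by (subst ln_less_cancel_iff) auto
          then show ?thesis using False r by (simp add: neg_ln_def ennreal_less_iff)
        qed (simp add: neg_ln_def r)
      qed
    qed auto
    then show ?thesis using True by (simp add: neg_ln_def)
  qed
qed

context fading_link
begin

lemma nn_integral_serving:
  assumes s [measurable]: "s \<in> borel_measurable borel" and s_pos: "\<And>r. 0 < s r"
  shows "(\<integral>\<^sup>+\<omega>. (\<Sum>n. of_bool (nearest n \<omega>) * ennreal (\<Sum>k<m. poisson_term k (ennreal (s (D n \<omega>)) * others n \<omega>))) \<partial>M)
    = (\<integral>\<^sup>+r. ennreal (exp (- V r)) * (\<integral>\<^sup>+\<omega>. ennreal (\<Sum>k<m. poisson_term k (ennreal (s r) * interf r \<omega>)) \<partial>M) \<partial>Lam)"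
proof -
  interpret L: sigma_finite_measure Lam
    using lam_pos h_pos by (intro sigma_finite_intensity) auto
  define \<mu> where "\<mu> = distr near_measure (borel \<Otimes>\<^sub>M borel) (\<lambda>p. (D (snd p) (fst p), exp_neg (others (snd p) (fst p))))"
  define \<nu> where "\<nu> = distr (density (Lam \<Otimes>\<^sub>M M) (\<lambda>p. ennreal (exp (- V (fst p))))) (borel \<Otimes>\<^sub>M borel)
     (\<lambda>p. (fst p, exp_neg (interf (fst p) (snd p))))"
  have [measurable]: "(\<lambda>p. interf (fst p) (snd p)) \<in> borel_measurable (Lam \<Otimes>\<^sub>M M)"
    using interf_measurable_pair by (simp add: case_prod_beta' cong: measurable_cong_sets)
  have \<mu>: "(\<integral>\<^sup>+p. f p \<partial>\<mu>) = (\<integral>\<^sup>+\<omega>. (\<Sum>n. of_bool (nearest n \<omega>) * f (D n \<omega>, exp_neg (others n \<omega>))) \<partial>M)"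
    if [measurable]: "f \<in> borel_measurable (borel \<Otimes>\<^sub>M borel)" for f
    unfolding \<mu>_def by (subst nn_integral_distr) (auto simp: nn_integral_near_measure)
  have \<nu>: "(\<integral>\<^sup>+p. f p \<partial>\<nu>) = (\<integral>\<^sup>+r. ennreal (exp (- V r)) * (\<integral>\<^sup>+\<omega>. f (r, exp_neg (interf r \<omega>)) \<partial>M) \<partial>Lam)"
    if [measurable]: "f \<in> borel_measurable (borel \<Otimes>\<^sub>M borel)" for f
  proof -
    have "(\<integral>\<^sup>+p. f p \<partial>\<nu>) = (\<integral>\<^sup>+p. ennreal (exp (- V (fst p))) * f (fst p, exp_neg (interf (fst p) (snd p))) \<partial>(Lam \<Otimes>\<^sub>M M))"
      unfolding \<nu>_def by (subst nn_integral_distr) (auto simp: nn_integral_density)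
    also have "\<dots> = (\<integral>\<^sup>+r. \<integral>\<^sup>+\<omega>. ennreal (exp (- V r)) * f (r, exp_neg (interf r \<omega>)) \<partial>M \<partial>Lam)"
      by (subst nn_integral_fst[symmetric]) auto
    also have "\<dots> = (\<integral>\<^sup>+r. ennreal (exp (- V r)) * (\<integral>\<^sup>+\<omega>. f (r, exp_neg (interf r \<omega>)) \<partial>M) \<partial>Lam)"
      by (intro nn_integral_cong nn_integral_cmult) measurable
    finally show ?thesis .
  qed
  have moments: "(\<integral>\<^sup>+p. indicator A (fst p) * ennreal (snd p ^ k) \<partial>\<mu>) = (\<integral>\<^sup>+p. indicator A (fst p) * ennreal (snd p ^ k) \<partial>\<nu>)"
    if A [measurable]: "A \<in> sets borel" for A k
  proof -
    note [measurable] = laplace_measurable[of "real k"]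
    have "(\<integral>\<^sup>+p. indicator A (fst p) * ennreal (snd p ^ k) \<partial>\<mu>) = emeasure (serving_measure (real k)) A"
      by (subst \<mu>) (auto simp: emeasure_serving_measure exp_neg_power ennreal_of_nat_eq_real_of_nat)
    also have "\<dots> = emeasure (serving_density_measure (real k)) A"
      by (subst serving_measure_eq) auto
    also have "\<dots> = (\<integral>\<^sup>+r. ennreal (exp (- V r)) * (indicator A r * ennreal (laplace (real k) r)) \<partial>Lam)"
      unfolding serving_density_measure_def
      by (subst emeasure_density) (auto simp: ennreal_mult laplace_bounds mult_ac)
    also have "\<dots> = (\<integral>\<^sup>+p. indicator A (fst p) * ennreal (snd p ^ k) \<partial>\<nu>)"
      by (subst \<nu>) (auto simp: nn_integral_cmult exp_neg_power ennreal_of_nat_eq_real_of_nat interf_laplace)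
    finally show ?thesis .
  qed
  have "emeasure \<mu> (space \<mu>) = (\<integral>\<^sup>+p. 1 \<partial>\<mu>)" by simp
  also have "\<dots> \<le> (\<integral>\<^sup>+\<omega>. 1 \<partial>M)"
  proof (subst \<mu>)
    show "(\<integral>\<^sup>+\<omega>. (\<Sum>n. of_bool (nearest n \<omega>) * 1) \<partial>M) \<le> (\<integral>\<^sup>+\<omega>. 1 \<partial>M)"
    proof (rule nn_integral_mono)
      fix \<omega>
      show "(\<Sum>n. of_bool (nearest n \<omega>) * 1) \<le> (1::ennreal)"
      proof (cases "\<exists>n. nearest n \<omega>")
        case True
        then show ?thesis using suminf_nearest[of _ \<omega> "\<lambda>_. 1"] by auto
      qed simp
    qed
  qed auto
  finally have fin\<mu>: "emeasure \<mu> (space \<mu>) \<le> 1" by (simp add: emeasure_space_1)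
  then have "emeasure \<nu> (space \<nu>) \<le> 1"
    using moments[of UNIV 0] by simp
  with fin\<mu> have fin: "finite_measure \<mu>" "finite_measure \<nu>"
    by (auto intro!: finite_measureI simp: top_unique)
  define F where "F p = (\<Sum>k<m. poisson_term k (ennreal (s (fst p)) * neg_ln (snd p)))" for p :: "real \<times> real"
  have [measurable]: "F \<in> borel_measurable (borel \<Otimes>\<^sub>M borel)"
    unfolding F_def[abs_def] by measurable
  have "(\<integral>\<^sup>+p. ennreal (F p) \<partial>\<mu>) = (\<integral>\<^sup>+p. ennreal (F p) \<partial>\<nu>)"
  proof (rule nn_integral_eq_of_mixed_moments[OF fin _ _ _ _ moments])
    show "AE p in \<mu>. snd p \<in> {0..1}" unfolding \<mu>_def by (subst AE_distr_iff) auto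
    show "AE p in \<nu>. snd p \<in> {0..1}" unfolding \<nu>_def by (subst AE_distr_iff) auto
    show "0 \<le> F (r, y) \<and> F (r, y) \<le> 1" for r y
      by (simp add: F_def sum_nonneg sum_poisson_term_le_1)
    show "continuous_on {0..1} (\<lambda>y. F (r, y))" for r
      using continuous_on_neg_ln unfolding F_def continuous_on_def fst_conv snd_conv
      by (auto intro!: tendsto_sum tendsto_poisson_term ennreal_tendsto_cmult)
  qed (auto simp: \<mu>_def \<nu>_def)
  then show ?thesis
    by (simp add: \<mu> \<nu> F_def)
qed

end

section \<open>Coverage as an integral over the serving distance\<close>

context fading_network
begin

lemma fading_tail:
  assumes c: "0 < c" and beta: "0 < beta"
  shows "(\<integral>\<^sup>+\<omega>. of_bool (ennreal beta \<le> ennreal (c * g n \<omega>) / z) \<partial>M)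
    = ennreal (\<Sum>k<m. poisson_term k (ennreal (real m * beta / c) * z))"
proof (cases z)
  case top
  then show ?thesis using c beta m_pos by (simp add: ennreal_mult_top)
next
  case (real z')
  define a where "a = beta * z' / c"
  have a: "0 \<le> a" using real c beta by (simp add: a_def)
  have "AE x in lborel. 0 < ennreal (erlang_density (m - 1) (real m) x) \<longrightarrow> x \<noteq> a"
    using AE_lborel_singleton[of a] by eventually_elim auto
  then have "AE \<omega> in M. g n \<omega> \<noteq> a"
    by (subst distributed_AE2[OF fading_erlang[of n]]) auto
  then have "AE \<omega> in M. (of_bool (ennreal beta \<le> ennreal (c * g n \<omega>) / z) :: ennreal)
      = indicator {\<omega>\<in>space M. a < g n \<omega>} \<omega>"
    using fading_pos AE_space
  proof eventually_elim
    case (elim \<omega>)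
    then have g: "0 < g n \<omega>" "g n \<omega> \<noteq> a" "\<omega> \<in> space M" by auto
    have "ennreal beta \<le> ennreal (c * g n \<omega>) / z \<longleftrightarrow> a < g n \<omega>"
    proof (cases "z' = 0")
      case True
      have "ennreal (c * g n \<omega>) \<noteq> 0" using g c by simp
      then show ?thesis using g real True by (simp add: a_def ennreal_divide_eq_top_iff)
    next
      case False
      then have z: "0 < z'" using real by simp
      then have "ennreal beta \<le> ennreal (c * g n \<omega>) / z \<longleftrightarrow> beta \<le> c * g n \<omega> / z'"
        using g c real by (simp add: divide_ennreal ennreal_le_iff)
      also have "\<dots> \<longleftrightarrow> a \<le> g n \<omega>"
        using z c by (simp add: a_def field_simps)
      finally show ?thesis using g by auto
    qed
    then show ?case using g by simp
  qed
  then have "(\<integral>\<^sup>+\<omega>. of_bool (ennreal beta \<le> ennreal (c * g n \<omega>) / z) \<partial>M)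
      = (\<integral>\<^sup>+\<omega>. indicator {\<omega>\<in>space M. a < g n \<omega>} \<omega> \<partial>M)"
    by (rule nn_integral_cong_AE)
  also have "\<dots> = ennreal (prob {\<omega>\<in>space M. a < g n \<omega>})"
    by (simp add: emeasure_eq_measure)
  also have "prob {\<omega>\<in>space M. a < g n \<omega>} = 1 - erlang_CDF (m - 1) (real m) a"
    using m_pos a by (intro erlang_distributed_gt[OF fading_erlang]) auto
  also have "\<dots> = (\<Sum>k\<le>m - 1. (real m * a) ^ k * exp (- real m * a) / fact k)"
    using a by (simp add: erlang_CDF_def)
  also have "{..m - 1} = {..<m}" using m_pos by auto
  also have "(\<Sum>k<m. (real m * a) ^ k * exp (- real m * a) / fact k) = (\<Sum>k<m. poisson_term k (ennreal (real m * a)))"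
    using a by (intro sum.cong) (auto simp: poisson_term_ennreal)
  also have "ennreal (real m * a) = ennreal (real m * beta / c) * z"
    using real c beta by (simp add: a_def ennreal_mult'[symmetric] mult_ac)
  finally show ?thesis .
qed

lemma fading_ratio_tail:
  fixes n :: nat and v :: "nat \<Rightarrow> real"
  assumes c: "0 < c" and beta: "0 < beta"
  defines "J \<equiv> \<lambda>\<omega>. \<Sum>k. if k = n then 0 else ennreal (v k * g k \<omega>)"
  shows "(\<integral>\<^sup>+\<omega>. of_bool (ennreal beta \<le> ennreal (c * g n \<omega>) / J \<omega>) \<partial>M)
    = (\<integral>\<^sup>+\<omega>. ennreal (\<Sum>k<m. poisson_term k (ennreal (real m * beta / c) * J \<omega>)) \<partial>M)"
proof -
  have [measurable]: "J \<in> borel_measurable M"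
    unfolding J_def by measurable
  have m2: "(\<lambda>x. \<Sum>k. if k = n then 0 else ennreal (v k * x k)) \<in> borel_measurable (Pi\<^sub>M (- {n}) (\<lambda>_. borel))"
  proof (intro borel_measurable_suminf_order)
    fix k
    show "(\<lambda>x. if k = n then 0 else ennreal (v k * x k)) \<in> borel_measurable (Pi\<^sub>M (- {n}) (\<lambda>_. borel))"
      by (cases "k = n") auto
  qed
  \<comment> \<open>The library predicate \<open>indep_var\<close> needs both variables in one type, hence \<open>ennreal \<circ> g n\<close>.\<close>
  let ?g = "\<lambda>\<omega>. ennreal (g n \<omega>)"
  have "indep_var borel ((\<lambda>x. ennreal (x n)) \<circ> (\<lambda>\<omega>. restrict (\<lambda>i. g i \<omega>) {n}))
     borel ((\<lambda>x. \<Sum>k. if k = n then 0 else ennreal (v k * x k)) \<circ> (\<lambda>\<omega>. restrict (\<lambda>i. g i \<omega>) (- {n})))"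
    by (intro indep_var_compose[OF indep_var_restrict[OF fading_indep]] m2) auto
  moreover have "(\<lambda>x. ennreal (x n)) \<circ> (\<lambda>\<omega>. restrict (\<lambda>i. g i \<omega>) {n}) = ?g" by auto
  moreover have "(\<lambda>x. \<Sum>k. if k = n then 0 else ennreal (v k * x k)) \<circ> (\<lambda>\<omega>. restrict (\<lambda>i. g i \<omega>) (- {n})) = J"
    by (auto simp: J_def fun_eq_iff intro!: suminf_cong)
  ultimately have "indep_var borel ?g borel J" by simp
  then have eq: "distr M borel ?g \<Otimes>\<^sub>M distr M borel J = distr M (borel \<Otimes>\<^sub>M borel) (\<lambda>\<omega>. (?g \<omega>, J \<omega>))"
    by (simp add: indep_var_distribution_eq)
  interpret G: prob_space "distr M borel ?g" by (rule prob_space_distr) simp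
  interpret JJ: prob_space "distr M borel J" by (rule prob_space_distr) simp
  interpret P: pair_sigma_finite "distr M borel ?g" "distr M borel J" ..
  have cg: "ennreal (c * g n \<omega>) = ennreal c * ?g \<omega>" for \<omega>
    using c by (simp add: ennreal_mult')
  have "(\<integral>\<^sup>+\<omega>. of_bool (ennreal beta \<le> ennreal (c * g n \<omega>) / J \<omega>) \<partial>M)
      = (\<integral>\<^sup>+p. of_bool (ennreal beta \<le> ennreal c * fst p / snd p) \<partial>(distr M borel ?g \<Otimes>\<^sub>M distr M borel J))"
    unfolding eq cg by (subst nn_integral_distr) auto
  also have "\<dots> = (\<integral>\<^sup>+z. \<integral>\<^sup>+y. of_bool (ennreal beta \<le> ennreal c * y / z) \<partial>distr M borel ?g \<partial>distr M borel J)"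
    by (subst P.nn_integral_snd[symmetric]) auto
  also have "\<dots> = (\<integral>\<^sup>+z. \<integral>\<^sup>+\<omega>. of_bool (ennreal beta \<le> ennreal (c * g n \<omega>) / z) \<partial>M \<partial>distr M borel J)"
    unfolding cg by (intro nn_integral_cong nn_integral_distr) auto
  also have "\<dots> = (\<integral>\<^sup>+z. ennreal (\<Sum>k<m. poisson_term k (ennreal (real m * beta / c) * z)) \<partial>distr M borel J)"
    by (simp add: fading_tail[OF c beta])
  also have "\<dots> = (\<integral>\<^sup>+\<omega>. ennreal (\<Sum>k<m. poisson_term k (ennreal (real m * beta / c) * J \<omega>)) \<partial>M)"
    by (subst nn_integral_distr) auto
  finally show ?thesis .
qed

end

context fading_link
begin

lemma coverage_nearest:
  assumes beta: "0 < beta"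
  shows "(\<integral>\<^sup>+\<omega>. of_bool (nearest n \<omega>) * of_bool (ennreal beta \<le> ennreal (w (D n \<omega>) * g n \<omega>) / others n \<omega>) \<partial>M)
    = (\<integral>\<^sup>+\<omega>. of_bool (nearest n \<omega>) * ennreal (\<Sum>k<m. poisson_term k (ennreal (real m * beta / w (D n \<omega>)) * others n \<omega>)) \<partial>M)"
proof -
  define N :: "(nat \<Rightarrow> real) \<Rightarrow> bool" where "N x \<longleftrightarrow> (\<forall>k. k \<noteq> n \<longrightarrow> x n < x k)" for x
  define J where "J x y = (\<Sum>k. if k = n then 0 else ennreal (w (x k) * y k))" for x y :: "nat \<Rightarrow> real"
  define F1 where "F1 = (\<lambda>(x, y). of_bool (N x) * of_bool (ennreal beta \<le> ennreal (w (x n) * y n) / J x y) :: ennreal)"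
  define F2 where "F2 = (\<lambda>(x, y). of_bool (N x) * ennreal (\<Sum>k<m. poisson_term k (ennreal (real m * beta / w (x n)) * J x y)))"
  have [measurable]: "F1 \<in> borel_measurable (Pi\<^sub>M UNIV (\<lambda>_. borel) \<Otimes>\<^sub>M Pi\<^sub>M UNIV (\<lambda>_. borel))"
    "F2 \<in> borel_measurable (Pi\<^sub>M UNIV (\<lambda>_. borel) \<Otimes>\<^sub>M Pi\<^sub>M UNIV (\<lambda>_. borel))"
    unfolding F1_def F2_def N_def J_def by measurable
  have [measurable]: "(\<lambda>\<omega>. J x (\<lambda>n. g n \<omega>)) \<in> borel_measurable M" for x
    unfolding J_def by measurable
  have "(\<integral>\<^sup>+\<omega>. of_bool (nearest n \<omega>) * of_bool (ennreal beta \<le> ennreal (w (D n \<omega>) * g n \<omega>) / others n \<omega>) \<partial>M)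
      = (\<integral>\<^sup>+\<omega>. F1 ((\<lambda>n. D n \<omega>), (\<lambda>n. g n \<omega>)) \<partial>M)"
    by (simp add: F1_def N_def J_def nearest_def others_def)
  also have "\<dots> = (\<integral>\<^sup>+\<omega>'. \<integral>\<^sup>+\<omega>. F1 ((\<lambda>n. D n \<omega>'), (\<lambda>n. g n \<omega>)) \<partial>M \<partial>M)"
    by (rule nn_integral_points_fading) measurable
  also have "\<dots> = (\<integral>\<^sup>+\<omega>'. \<integral>\<^sup>+\<omega>. F2 ((\<lambda>n. D n \<omega>'), (\<lambda>n. g n \<omega>)) \<partial>M \<partial>M)"
  proof (rule nn_integral_cong)
    fix \<omega>'
    show "(\<integral>\<^sup>+\<omega>. F1 ((\<lambda>n. D n \<omega>'), (\<lambda>n. g n \<omega>)) \<partial>M) = (\<integral>\<^sup>+\<omega>. F2 ((\<lambda>n. D n \<omega>'), (\<lambda>n. g n \<omega>)) \<partial>M)"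
      using fading_ratio_tail[OF w_pos[of "D n \<omega>'"] beta, of n "\<lambda>k. w (D k \<omega>')"]
      by (simp add: F1_def F2_def nn_integral_cmult J_def)
  qed
  also have "\<dots> = (\<integral>\<^sup>+\<omega>. F2 ((\<lambda>n. D n \<omega>), (\<lambda>n. g n \<omega>)) \<partial>M)"
    by (rule nn_integral_points_fading[symmetric]) measurable
  also have "\<dots> = (\<integral>\<^sup>+\<omega>. of_bool (nearest n \<omega>) * ennreal (\<Sum>k<m. poisson_term k (ennreal (real m * beta / w (D n \<omega>)) * others n \<omega>)) \<partial>M)"
    by (simp add: F2_def N_def J_def nearest_def others_def)
  finally show ?thesis .
qed

theorem coverage_formula:
  assumes beta: "0 < beta"
  shows "emeasure M {\<omega>\<in>space M. \<exists>n. nearest n \<omega> \<and> ennreal beta \<le> ennreal (w (D n \<omega>) * g n \<omega>) / others n \<omega>}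
    = (\<integral>\<^sup>+r. ennreal (exp (- V r)) * (\<integral>\<^sup>+\<omega>. ennreal (\<Sum>k<m. poisson_term k (ennreal (real m * beta / w r) * interf r \<omega>)) \<partial>M) \<partial>Lam)"
proof -
  let ?C = "\<lambda>n \<omega>. ennreal beta \<le> ennreal (w (D n \<omega>) * g n \<omega>) / others n \<omega>"
  have m_pos': "0 < real m" using m_pos by simp
  have "emeasure M {\<omega>\<in>space M. \<exists>n. nearest n \<omega> \<and> ?C n \<omega>}
      = (\<integral>\<^sup>+\<omega>. indicator {\<omega>\<in>space M. \<exists>n. nearest n \<omega> \<and> ?C n \<omega>} \<omega> \<partial>M)"
    by (rule nn_integral_indicator[symmetric]) measurable
  also have "\<dots> = (\<integral>\<^sup>+\<omega>. (\<Sum>n. of_bool (nearest n \<omega>) * of_bool (?C n \<omega>)) \<partial>M)"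
  proof (rule nn_integral_cong)
    fix \<omega> assume \<omega>: "\<omega> \<in> space M"
    show "indicator {\<omega>\<in>space M. \<exists>n. nearest n \<omega> \<and> ?C n \<omega>} \<omega> = (\<Sum>n. of_bool (nearest n \<omega>) * of_bool (?C n \<omega>) :: ennreal)"
    proof (cases "\<exists>n. nearest n \<omega>")
      case True
      then obtain n where n: "nearest n \<omega>" by blast
      have "(\<exists>k. nearest k \<omega> \<and> ?C k \<omega>) \<longleftrightarrow> ?C n \<omega>" using nearest_unique[OF n] n by blast
      then show ?thesis using \<omega> by (simp add: suminf_nearest[OF n] indicator_def)
    next
      case False
      then show ?thesis by simp
    qed
  qed
  also have "\<dots> = (\<Sum>n. \<integral>\<^sup>+\<omega>. of_bool (nearest n \<omega>) * of_bool (?C n \<omega>) \<partial>M)"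
    by (rule nn_integral_suminf) measurable
  also have "\<dots> = (\<Sum>n. \<integral>\<^sup>+\<omega>. of_bool (nearest n \<omega>)
      * ennreal (\<Sum>k<m. poisson_term k (ennreal (real m * beta / w (D n \<omega>)) * others n \<omega>)) \<partial>M)"
    by (simp only: coverage_nearest[OF beta])
  also have "\<dots> = (\<integral>\<^sup>+\<omega>. (\<Sum>n. of_bool (nearest n \<omega>)
      * ennreal (\<Sum>k<m. poisson_term k (ennreal (real m * beta / w (D n \<omega>)) * others n \<omega>))) \<partial>M)"
    by (rule nn_integral_suminf[symmetric]) measurable
  also have "\<dots> = (\<integral>\<^sup>+r. ennreal (exp (- V r))
      * (\<integral>\<^sup>+\<omega>. ennreal (\<Sum>k<m. poisson_term k (ennreal (real m * beta / w r) * interf r \<omega>)) \<partial>M) \<partial>Lam)"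
    using m_pos' beta w_pos by (intro nn_integral_serving[of "\<lambda>r. real m * beta / w r"]) auto
  finally show ?thesis .
qed

end

lemma (in prob_space) higher_deriv_laplace:
  fixes Z :: "'a \<Rightarrow> ennreal"
  assumes Z [measurable]: "Z \<in> borel_measurable M"
    and f: "\<And>s. 0 < s \<Longrightarrow> f s = (\<integral>\<omega>. exp_neg (ennreal s * Z \<omega>) \<partial>M)"
    and s: "0 < s"
  shows "(- s) ^ k / fact k * (deriv ^^ k) f s = (\<integral>\<omega>. poisson_term k (ennreal s * Z \<omega>) \<partial>M)"
proof -
  define z where "z \<omega> = enn2real (Z \<omega>)" for \<omega>
  define A where "A = {\<omega>\<in>space M. Z \<omega> \<noteq> \<infinity>}"
  define \<phi> where "\<phi> k s \<omega> = indicator A \<omega> * ((- z \<omega>) ^ k * exp (- s * z \<omega>))" for k s \<omega>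
  have z0: "0 \<le> z \<omega>" for \<omega> by (simp add: z_def)
  have [measurable]: "A \<in> sets M" unfolding A_def by measurable
  have [measurable]: "z \<in> borel_measurable M" unfolding z_def[abs_def] by measurable
  have \<phi>_meas [measurable]: "\<phi> k s \<in> borel_measurable M" for k s
    unfolding \<phi>_def[abs_def] by measurable
  have pt: "(s * z \<omega>) ^ k / fact k * exp (- s * z \<omega>) \<le> 1" if "0 \<le> s" for s k \<omega>
    using poisson_term_le_1[of k "ennreal (s * z \<omega>)"] z0[of \<omega>] that by (simp add: poisson_term_ennreal)
  have \<phi>_bound: "norm (\<phi> k s \<omega>) \<le> fact k / s0 ^ k" if "0 < s0" "s0 \<le> s" for k s s0 \<omega>
  proof -
    have "norm (\<phi> k s \<omega>) \<le> z \<omega> ^ k * exp (- s * z \<omega>)"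
      using z0[of \<omega>] by (auto simp: \<phi>_def abs_mult power_abs split: split_indicator)
    also have "\<dots> \<le> z \<omega> ^ k * exp (- s0 * z \<omega>)"
      using z0[of \<omega>] that by (intro mult_left_mono) (auto intro: mult_right_mono)
    also have "\<dots> = fact k / s0 ^ k * ((s0 * z \<omega>) ^ k / fact k * exp (- s0 * z \<omega>))"
      using that by (simp add: power_mult_distrib)
    also have "\<dots> \<le> fact k / s0 ^ k * 1"
      using that by (intro mult_left_mono pt) auto
    finally show ?thesis by simp
  qed
  have \<phi>_int: "integrable M (\<phi> k s)" if "0 < s" for k s
    using \<phi>_bound[OF that order_refl] by (intro integrable_const_bound[where B = "fact k / s ^ k"]) auto
  have deriv: "((\<lambda>s. \<integral>\<omega>. \<phi> k s \<omega> \<partial>M) has_real_derivative (\<integral>\<omega>. \<phi> (Suc k) s \<omega> \<partial>M)) (at s)" if s: "0 < s" for k s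
  proof -
    define s0 where "s0 = s / 2"
    have s0: "0 < s0" "s0 < s" using s by (auto simp: s0_def)
    have der: "((\<lambda>s. \<phi> k s \<omega>) has_real_derivative \<phi> (Suc k) s \<omega>) (at s within S)" for s S \<omega>
      unfolding \<phi>_def by (auto intro!: derivative_eq_intros simp: mult_ac)
    have "((\<lambda>y. ((\<integral>\<omega>. \<phi> k y \<omega> \<partial>M) - (\<integral>\<omega>. \<phi> k s \<omega> \<partial>M)) / (y - s)) \<longlongrightarrow> (\<integral>\<omega>. \<phi> (Suc k) s \<omega> \<partial>M)) (at s)"
    proof (rule tendsto_at_iff_sequentially[THEN iffD2], intro allI impI, simp only: comp_def)
      fix X :: "nat \<Rightarrow> real" assume X: "\<forall>i. X i \<in> UNIV - {s}" "X \<longlonglongrightarrow> s"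
      have ev: "eventually (\<lambda>i. s0 < X i) sequentially"
        using order_tendstoD(1)[OF X(2) s0(2)] .
      have "(\<lambda>i. \<integral>\<omega>. of_bool (s0 < X i) * ((\<phi> k (X i) \<omega> - \<phi> k s \<omega>) / (X i - s)) \<partial>M) \<longlonglongrightarrow> (\<integral>\<omega>. \<phi> (Suc k) s \<omega> \<partial>M)"
      proof (rule integral_dominated_convergence[where w = "\<lambda>_. fact (Suc k) / s0 ^ Suc k"])
        show "AE \<omega> in M. (\<lambda>i. of_bool (s0 < X i) * ((\<phi> k (X i) \<omega> - \<phi> k s \<omega>) / (X i - s))) \<longlonglongrightarrow> \<phi> (Suc k) s \<omega>"
        proof (rule AE_I2)
          fix \<omega>
          have "((\<lambda>y. (\<phi> k y \<omega> - \<phi> k s \<omega>) / (y - s)) \<longlongrightarrow> \<phi> (Suc k) s \<omega>) (at s)"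
            using der[of \<omega> s UNIV] by (simp add: has_field_derivative_iff)
          then have "(\<lambda>i. (\<phi> k (X i) \<omega> - \<phi> k s \<omega>) / (X i - s)) \<longlonglongrightarrow> \<phi> (Suc k) s \<omega>"
            using X unfolding tendsto_at_iff_sequentially comp_def by auto
          moreover have "\<forall>\<^sub>F i in sequentially. (\<phi> k (X i) \<omega> - \<phi> k s \<omega>) / (X i - s)
              = of_bool (s0 < X i) * ((\<phi> k (X i) \<omega> - \<phi> k s \<omega>) / (X i - s))"
            using ev by eventually_elim simp
          ultimately show "(\<lambda>i. of_bool (s0 < X i) * ((\<phi> k (X i) \<omega> - \<phi> k s \<omega>) / (X i - s))) \<longlonglongrightarrow> \<phi> (Suc k) s \<omega>"
            by (rule Lim_transform_eventually)
        qed
        show "AE \<omega> in M. norm (of_bool (s0 < X i) * ((\<phi> k (X i) \<omega> - \<phi> k s \<omega>) / (X i - s))) \<le> fact (Suc k) / s0 ^ Suc k" for i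
        proof (rule AE_I2)
          fix \<omega>
          show "norm (of_bool (s0 < X i) * ((\<phi> k (X i) \<omega> - \<phi> k s \<omega>) / (X i - s))) \<le> fact (Suc k) / s0 ^ Suc k"
          proof (cases "s0 < X i")
            case True
            have "norm (\<phi> k (X i) \<omega> - \<phi> k s \<omega>) \<le> fact (Suc k) / s0 ^ Suc k * norm (X i - s)"
              by (rule field_differentiable_bound[where S = "{s0..}" and f' = "\<lambda>s. \<phi> (Suc k) s \<omega>"])
                 (use True s0 der \<phi>_bound[OF s0(1), of _ "Suc k" \<omega>] in auto)
            moreover have "0 < norm (X i - s)" using X by auto
            ultimately show ?thesis using True by (simp add: divide_le_eq norm_divide del: power_Suc fact_Suc)
          qed (use s0 in auto)
        qed
      qed auto
      moreover have "\<forall>\<^sub>F i in sequentially. (\<integral>\<omega>. of_bool (s0 < X i) * ((\<phi> k (X i) \<omega> - \<phi> k s \<omega>) / (X i - s)) \<partial>M)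
          = ((\<integral>\<omega>. \<phi> k (X i) \<omega> \<partial>M) - (\<integral>\<omega>. \<phi> k s \<omega> \<partial>M)) / (X i - s)"
        using ev
      proof eventually_elim
        case (elim i)
        then have "0 < X i" using s0 by simp
        then show ?case using elim s \<phi>_int by simp
      qed
      ultimately show "(\<lambda>i. ((\<integral>\<omega>. \<phi> k (X i) \<omega> \<partial>M) - (\<integral>\<omega>. \<phi> k s \<omega> \<partial>M)) / (X i - s)) \<longlonglongrightarrow> (\<integral>\<omega>. \<phi> (Suc k) s \<omega> \<partial>M)"
        by (rule Lim_transform_eventually)
    qed
    then show ?thesis by (simp add: has_field_derivative_iff)
  qed
  have iter: "\<forall>s>0. (deriv ^^ k) f s = (\<integral>\<omega>. \<phi> k s \<omega> \<partial>M)" for k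
  proof (induction k)
    case 0
    have "exp_neg (ennreal s * Z \<omega>) = \<phi> 0 s \<omega>" if "0 < s" "\<omega> \<in> space M" for s \<omega>
    proof (cases "Z \<omega>")
      case (real r)
      then show ?thesis using that by (simp add: \<phi>_def A_def z_def ennreal_mult'[symmetric] exp_neg_ennreal)
    next
      case top
      then show ?thesis using that by (simp add: \<phi>_def A_def ennreal_mult_top)
    qed
    then show ?case by (auto simp: f intro!: Bochner_Integration.integral_cong)
  next
    case (Suc k)
    show ?case
    proof (intro allI impI)
      fix s :: real assume s: "0 < s"
      have "eventually (\<lambda>y. (deriv ^^ k) f y = (\<integral>\<omega>. \<phi> k y \<omega> \<partial>M)) (nhds s)"
        using eventually_nhds_in_open[of "{0<..}" s] s Suc by (auto elim: eventually_mono)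
      then have "deriv ((deriv ^^ k) f) s = deriv (\<lambda>y. \<integral>\<omega>. \<phi> k y \<omega> \<partial>M) s"
        by (rule deriv_cong_ev) simp
      also have "\<dots> = (\<integral>\<omega>. \<phi> (Suc k) s \<omega> \<partial>M)"
        by (rule DERIV_imp_deriv[OF deriv[OF s]])
      finally show "(deriv ^^ Suc k) f s = (\<integral>\<omega>. \<phi> (Suc k) s \<omega> \<partial>M)" by simp
    qed
  qed
  have "(- s) ^ k / fact k * (deriv ^^ k) f s = (\<integral>\<omega>. (- s) ^ k / fact k * \<phi> k s \<omega> \<partial>M)"
    using iter s by simp
  also have "\<dots> = (\<integral>\<omega>. poisson_term k (ennreal s * Z \<omega>) \<partial>M)"
  proof (rule Bochner_Integration.integral_cong[OF refl])
    fix \<omega> assume "\<omega> \<in> space M"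
    show "(- s) ^ k / fact k * \<phi> k s \<omega> = poisson_term k (ennreal s * Z \<omega>)"
    proof (cases "Z \<omega>")
      case (real r)
      then show ?thesis
        using s \<open>\<omega> \<in> space M\<close>
        by (simp add: \<phi>_def A_def z_def ennreal_mult'[symmetric] poisson_term_ennreal power_mult_distrib[symmetric])
    next
      case top
      then show ?thesis using s by (simp add: \<phi>_def A_def ennreal_mult_top)
    qed
  qed
  finally show ?thesis .
qed

section \<open>From the planar process to the coverage formula\<close>

lemma intensity_eq_distr_lborel:
  assumes lam: "0 < lam" and h: "0 < h"
  shows "distr (density lborel (\<lambda>_. ennreal lam)) borel (\<lambda>x :: real \<times> real. sqrt ((norm x)\<^sup>2 + h\<^sup>2)) = intensity lam h"
    (is "distr ?L borel ?d = _")
proof (rule measure_eqI_Ioc)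
  have em: "emeasure (distr ?L borel ?d) A = ennreal lam * emeasure lborel (?d -` A)" if [measurable]: "A \<in> sets borel" for A
  proof -
    have [measurable]: "?d -` A \<in> sets borel"
      using measurable_sets[of ?d borel borel A] by simp
    show ?thesis
      by (simp add: emeasure_distr emeasure_density nn_integral_cmult)
  qed
  have ge: "h \<le> ?d x" for x
    using h by (intro real_le_rsqrt) auto
  have ball: "{x. ?d x \<le> t} = cball 0 (sqrt (t\<^sup>2 - h\<^sup>2))" if "h \<le> t" for t
  proof -
    have "?d x \<le> t \<longleftrightarrow> norm x \<le> sqrt (t\<^sup>2 - h\<^sup>2)" for x :: "real \<times> real"
    proof -
      have "?d x \<le> t \<longleftrightarrow> (norm x)\<^sup>2 + h\<^sup>2 \<le> t\<^sup>2"
        using h that by (auto intro: real_le_lsqrt dest: sqrt_le_D)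
      also have "\<dots> \<longleftrightarrow> (norm x)\<^sup>2 \<le> t\<^sup>2 - h\<^sup>2" by auto
      also have "\<dots> \<longleftrightarrow> norm x \<le> sqrt (t\<^sup>2 - h\<^sup>2)"
        using real_le_rsqrt[of "norm x" "t\<^sup>2 - h\<^sup>2"] sqrt_ge_absD[of "norm x" "t\<^sup>2 - h\<^sup>2"] by auto
      finally show ?thesis .
    qed
    then show ?thesis by (auto simp: mem_cball_0)
  qed
  have vol: "emeasure lborel {x. ?d x \<le> t} = ennreal (pi * (t\<^sup>2 - h\<^sup>2))" if "h \<le> t" for t
  proof -
    have "0 \<le> t\<^sup>2 - h\<^sup>2" using h that by (simp add: power_mono)
    then show ?thesis
      unfolding ball[OF that] by (subst emeasure_cball) (auto simp: unit_ball_vol_2)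
  qed
  fix a b :: real assume ab: "a \<le> b"
  have vim: "?d -` {a<..b} = {x. ?d x \<le> b} - {x. ?d x \<le> a}" by auto
  have "ennreal lam * emeasure lborel (?d -` {a<..b}) = ennreal (cum_intensity lam h b - cum_intensity lam h a)"
  proof -
    consider "b < h" | "a < h" "h \<le> b" | "h \<le> a" by linarith
    then show ?thesis
    proof cases
      case 1
      have "x \<notin> ?d -` {a<..b}" for x
        unfolding vimage_eq greaterThanAtMost_iff using ge[of x] 1 by linarith
      then have "?d -` {a<..b} = {}" by blast
      then show ?thesis using 1 ab by (simp add: cum_intensity_def)
    next
      case 2
      have "\<not> ?d x \<le> a" for x using ge[of x] 2 by linarith
      then have "{x. ?d x \<le> a} = {}" by blast
      with vim have "?d -` {a<..b} = {x. ?d x \<le> b}" by (simp only: Diff_empty)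
      then show ?thesis
        using 2 lam by (simp add: vol cum_intensity_def ennreal_mult'[symmetric] mult_ac)
    next
      case 3
      have "emeasure lborel ({x. ?d x \<le> b} - {x. ?d x \<le> a}) = emeasure lborel {x. ?d x \<le> b} - emeasure lborel {x. ?d x \<le> a}"
        using 3 ab by (intro emeasure_Diff) (auto simp: vol)
      also have "\<dots> = ennreal (pi * (b\<^sup>2 - h\<^sup>2) - pi * (a\<^sup>2 - h\<^sup>2))"
        using 3 ab h by (simp add: vol ennreal_minus power_mono)
      finally show ?thesis
        using 3 lam ab unfolding vim by (simp add: cum_intensity_def ennreal_mult'[symmetric] algebra_simps)
    qed
  qed
  then show "emeasure (distr ?L borel ?d) {a<..b} = emeasure (intensity lam h) {a<..b}"
    "emeasure (distr ?L borel ?d) {a<..b} \<noteq> \<infinity>"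
    using lam h ab by (simp_all add: em emeasure_intensity_Ioc)
qed simp_all

lemma measure_intensity_eq:
  assumes "0 < lam" "0 < h" and B: "B \<in> sets borel"
  shows "measure (intensity lam h) B = lam * measure lborel {x :: real \<times> real. sqrt ((norm x)\<^sup>2 + h\<^sup>2) \<in> B}"
proof -
  let ?d = "\<lambda>x :: real \<times> real. sqrt ((norm x)\<^sup>2 + h\<^sup>2)"
  have [measurable]: "?d -` B \<in> sets borel"
    using measurable_sets[of ?d borel borel B] B by simp
  have "measure (intensity lam h) B = enn2real (ennreal lam * emeasure lborel (?d -` B))"
    using B unfolding intensity_eq_distr_lborel[OF assms(1,2), symmetric] measure_def
    by (simp add: emeasure_distr emeasure_density nn_integral_cmult)
  then show ?thesis
    using assms by (simp add: enn2real_mult measure_def vimage_def)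
qed

context fading_link
begin

definition cov_integrand :: "real \<Rightarrow> nat \<Rightarrow> real \<Rightarrow> real" where
  "cov_integrand beta k r = f_r0 lam h r * (\<integral>\<omega>. poisson_term k (ennreal (real m * beta / w r) * interf r \<omega>) \<partial>M)"

lemma f_r0_nonneg: "0 \<le> f_r0 lam h r"
  using lam_pos h_pos by (simp add: f_r0_def)

lemma f_r0_eq: "ennreal (2 * pi * lam * r) * indicator {h..} r * ennreal (exp (- V r)) = ennreal (f_r0 lam h r)"
  using lam_pos h_pos
  by (auto simp: f_r0_def cum_intensity_def ennreal_mult'[symmetric] mult_ac split: split_indicator)

lemma cov_integrand_measurable [measurable]: "cov_integrand beta k \<in> borel_measurable borel"
proof -
  have "(\<lambda>r. \<integral>\<omega>. poisson_term k (ennreal (real m * beta / w r) * interf r \<omega>) \<partial>M) \<in> borel_measurable borel"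
    using interf_measurable_pair
    by (intro borel_measurable_lebesgue_integral) (simp add: case_prod_beta', measurable)
  then show ?thesis
    unfolding cov_integrand_def[abs_def] f_r0_def by measurable
qed

lemma cov_integrand_nonneg: "0 \<le> cov_integrand beta k r"
  unfolding cov_integrand_def by (intro mult_nonneg_nonneg f_r0_nonneg Bochner_Integration.integral_nonneg) simp

lemma
  assumes beta: "0 < beta"
  shows coverage_eq_sum: "measure M {\<omega>\<in>space M. \<exists>n. nearest n \<omega> \<and> ennreal beta \<le> ennreal (w (D n \<omega>) * g n \<omega>) / others n \<omega>}
      = (\<Sum>k<m. \<integral>r. cov_integrand beta k r \<partial>lborel)"
    and integrable_cov_integrand: "k < m \<Longrightarrow> integrable lborel (cov_integrand beta k)"
proof -
  let ?E = "{\<omega>\<in>space M. \<exists>n. nearest n \<omega> \<and> ennreal beta \<le> ennreal (w (D n \<omega>) * g n \<omega>) / others n \<omega>}"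
  let ?s = "\<lambda>r. ennreal (real m * beta / w r)"
  have [measurable]: "(\<lambda>p. interf (fst p) (snd p)) \<in> borel_measurable (borel \<Otimes>\<^sub>M M)"
    using interf_measurable_pair by (simp add: case_prod_beta')
  have inner: "(\<integral>\<^sup>+\<omega>. ennreal (\<Sum>k<m. poisson_term k (?s r * interf r \<omega>)) \<partial>M)
      = ennreal (\<Sum>k<m. \<integral>\<omega>. poisson_term k (?s r * interf r \<omega>) \<partial>M)" for r
  proof -
    have int: "integrable M (\<lambda>\<omega>. poisson_term k (?s r * interf r \<omega>))" for k
      by (rule integrable_const_bound[where B = 1]) (auto simp: poisson_term_le_1)
    have "(\<integral>\<^sup>+\<omega>. ennreal (\<Sum>k<m. poisson_term k (?s r * interf r \<omega>)) \<partial>M)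
        = ennreal (\<integral>\<omega>. (\<Sum>k<m. poisson_term k (?s r * interf r \<omega>)) \<partial>M)"
      by (rule nn_integral_eq_integral) (auto intro!: sum_nonneg int)
    then show ?thesis by (simp add: int)
  qed
  have [measurable]: "(\<lambda>r. \<integral>\<^sup>+\<omega>. ennreal (\<Sum>k<m. poisson_term k (?s r * interf r \<omega>)) \<partial>M) \<in> borel_measurable borel"
    by measurable
  have "emeasure M ?E = (\<integral>\<^sup>+r. ennreal (2 * pi * lam * r) * indicator {h..} r * (ennreal (exp (- V r))
      * (\<integral>\<^sup>+\<omega>. ennreal (\<Sum>k<m. poisson_term k (?s r * interf r \<omega>)) \<partial>M)) \<partial>lborel)"
    unfolding coverage_formula[OF beta] by (rule nn_integral_intensity) measurable
  also have "\<dots> = (\<integral>\<^sup>+r. (\<Sum>k<m. ennreal (cov_integrand beta k r)) \<partial>lborel)"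
  proof (rule nn_integral_cong)
    fix r
    have "ennreal (2 * pi * lam * r) * indicator {h..} r * (ennreal (exp (- V r))
      * (\<integral>\<^sup>+\<omega>. ennreal (\<Sum>k<m. poisson_term k (?s r * interf r \<omega>)) \<partial>M))
      = ennreal (f_r0 lam h r) * ennreal (\<Sum>k<m. \<integral>\<omega>. poisson_term k (?s r * interf r \<omega>) \<partial>M)"
      unfolding inner f_r0_eq[symmetric] by (simp add: mult_ac)
    also have "\<dots> = ennreal (\<Sum>k<m. cov_integrand beta k r)"
      by (simp add: ennreal_mult'[symmetric] f_r0_nonneg cov_integrand_def sum_distrib_left)
    also have "\<dots> = (\<Sum>k<m. ennreal (cov_integrand beta k r))"
      by (rule sum_ennreal[symmetric]) (simp add: cov_integrand_nonneg)
    finally show "ennreal (2 * pi * lam * r) * indicator {h..} r * (ennreal (exp (- V r))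
      * (\<integral>\<^sup>+\<omega>. ennreal (\<Sum>k<m. poisson_term k (?s r * interf r \<omega>)) \<partial>M)) = (\<Sum>k<m. ennreal (cov_integrand beta k r))" .
  qed
  also have "\<dots> = (\<Sum>k<m. \<integral>\<^sup>+r. ennreal (cov_integrand beta k r) \<partial>lborel)"
    by (rule nn_integral_sum) simp
  finally have eq: "emeasure M ?E = (\<Sum>k<m. \<integral>\<^sup>+r. ennreal (cov_integrand beta k r) \<partial>lborel)" .
  have int: "integrable lborel (cov_integrand beta k)" if "k < m" for k
  proof (rule integrableI_nonneg)
    have "(\<integral>\<^sup>+r. ennreal (cov_integrand beta k r) \<partial>lborel) \<le> (\<Sum>k<m. \<integral>\<^sup>+r. ennreal (cov_integrand beta k r) \<partial>lborel)"
      using that by (intro member_le_sum) auto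
    also have "\<dots> \<le> 1" unfolding eq[symmetric] by (simp add: emeasure_eq_measure)
    also have "\<dots> < \<infinity>" by simp
    finally show "(\<integral>\<^sup>+r. ennreal (cov_integrand beta k r) \<partial>lborel) < \<infinity>" .
  qed (auto simp: cov_integrand_nonneg)
  then show "k < m \<Longrightarrow> integrable lborel (cov_integrand beta k)" .
  have "emeasure M ?E = (\<Sum>k<m. ennreal (\<integral>r. cov_integrand beta k r \<partial>lborel))"
    unfolding eq using int by (intro sum.cong refl nn_integral_eq_integral) (auto simp: cov_integrand_nonneg)
  also have "\<dots> = ennreal (\<Sum>k<m. \<integral>r. cov_integrand beta k r \<partial>lborel)"
    by (rule sum_ennreal) (simp add: cov_integrand_nonneg Bochner_Integration.integral_nonneg)
  finally show "measure M ?E = (\<Sum>k<m. \<integral>r. cov_integrand beta k r \<partial>lborel)"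
    by (simp add: measure_def sum_nonneg cov_integrand_nonneg Bochner_Integration.integral_nonneg)
qed

lemma cov_term_eq_cov_integrand:
  assumes w: "\<And>t. h \<le> t \<Longrightarrow> w t = P_T * G t * t powr (- alpha)"
    and beta: "0 < beta" and P: "0 < P_T" and G: "0 < G r"
  shows "cov_term lam P_T m alpha G h beta k (G r) r = cov_integrand beta k r"
proof (cases "h \<le> r")
  case False
  then show ?thesis by (simp add: cov_term_def cov_integrand_def f_r0_def)
next
  case True
  then have r: "0 < r" using h_pos by simp
  let ?s = "real m * beta / w r"
  have s: "0 < ?s" using m_pos beta w_pos[of r] by simp
  have LI: "LI lam P_T m alpha G r s = (\<integral>\<omega>. exp_neg (ennreal s * interf r \<omega>) \<partial>M)" if s: "0 < s" for s
  proof -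
    define u where "u t = 1 - (real m / (real m + s * w t)) ^ m" for t
    have [measurable]: "u \<in> borel_measurable borel" unfolding u_def[abs_def] by measurable
    have u0: "0 \<le> u t" for t
      using s w_pos[of t] m_pos by (simp add: u_def power_le_one divide_le_eq)
    define J where "J = (\<integral>\<^sup>+ t \<in> {r..}. ennreal
                 ((1 - (real m / (real m + s * P_T * G t * t powr (- alpha))) ^ m) * t) \<partial>lborel)"
    have J: "J = (\<integral>\<^sup>+t. ennreal (u t * t) * indicator {r..} t \<partial>lborel)"
      unfolding J_def using True w
      by (intro nn_integral_cong) (auto simp: u_def mult.assoc split: split_indicator)
    have "(\<integral>\<^sup>+t. ennreal (u t) * indicator {r<..} t \<partial>Lam)
        = (\<integral>\<^sup>+t. ennreal (2 * pi * lam * t) * indicator {h..} t * (ennreal (u t) * indicator {r<..} t) \<partial>lborel)"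
      by (rule nn_integral_intensity) measurable
    also have "\<dots> = (\<integral>\<^sup>+t. ennreal (2 * pi * lam) * (ennreal (u t * t) * indicator {r..} t) \<partial>lborel)"
    proof (rule nn_integral_cong_AE)
      show "AE t in lborel. ennreal (2 * pi * lam * t) * indicator {h..} t * (ennreal (u t) * indicator {r<..} t)
          = ennreal (2 * pi * lam) * (ennreal (u t * t) * indicator {r..} t)"
        using AE_lborel_singleton[of r]
      proof eventually_elim
        case (elim t)
        show ?case
        proof (cases "r < t")
          case t: True
          then show ?thesis
            using True r lam_pos u0[of t] by (simp add: ennreal_mult'[symmetric] mult_ac)
        next
          case False
          then show ?thesis using elim by simp
        qed
      qed
    qed
    also have "\<dots> = ennreal (2 * pi * lam) * J"
      unfolding J by (rule nn_integral_cmult) measurable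
    finally have lap: "laplace s r = exp_neg (ennreal (2 * pi * lam) * J)"
      by (simp add: laplace_def u_def)
    have "LI lam P_T m alpha G r s = (if J = \<infinity> then 0 else exp (- 2 * pi * lam * enn2real J))"
      by (simp add: LI_def J_def Let_def)
    also have "\<dots> = laplace s r"
      using lam_pos by (cases J) (auto simp: lap ennreal_mult_top ennreal_mult'[symmetric] exp_neg_ennreal)
    finally have "LI lam P_T m alpha G r s = laplace s r" .
    moreover have "ennreal (\<integral>\<omega>. exp_neg (ennreal s * interf r \<omega>) \<partial>M) = ennreal (laplace s r)"
      unfolding interf_laplace[OF less_imp_le[OF s], symmetric]
      by (rule nn_integral_eq_integral[symmetric])
         (auto intro!: integrable_const_bound[where B = 1])
    ultimately show ?thesis
      by (simp add: laplace_bounds Bochner_Integration.integral_nonneg)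
  qed
  have s_eq: "?s = real m * beta * r powr alpha / (P_T * G r)"
    using True r by (simp add: w powr_minus divide_inverse)
  have "cov_term lam P_T m alpha G h beta k (G r) r
      = ((- ?s) ^ k / fact k * (deriv ^^ k) (LI lam P_T m alpha G r) ?s) * f_r0 lam h r"
  proof -
    have "(- ?s) ^ k = (-1) ^ k * ?s ^ k" by (rule power_minus)
    moreover have "?s ^ k = (real m * beta) ^ k * (r powr (real k * alpha) / (P_T * G r) ^ k)"
      unfolding s_eq using r by (simp add: power_divide power_mult_distrib powr_power mult.commute)
    ultimately show ?thesis
      unfolding cov_term_def s_eq[symmetric] by (simp add: mult_ac)
  qed
  also have "(- ?s) ^ k / fact k * (deriv ^^ k) (LI lam P_T m alpha G r) ?s
      = (\<integral>\<omega>. poisson_term k (ennreal ?s * interf r \<omega>) \<partial>M)"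
    by (rule higher_deriv_laplace[OF _ LI s]) auto
  finally show ?thesis by (simp add: cov_integrand_def)
qed

end

lemma gain_pos: "0 < gain h th_t th_3dB A_V r"
  by (simp add: gain_def AVL_def GammaV_def)

lemma gain_measurable:
  assumes h: "0 < h"
  shows "(\<lambda>t. gain h th_t th_3dB A_V (max t h)) \<in> borel_measurable borel"
proof -
  have "continuous_on UNIV (\<lambda>t. arcsin (h / max t h))"
    using h by (intro continuous_on_arcsin continuous_intros) (auto simp: max_def field_simps)
  then have [measurable]: "(\<lambda>t. arcsin (h / max t h)) \<in> borel_measurable borel"
    by (rule borel_measurable_continuous_onI)
  show ?thesis
    unfolding gain_def GammaV_def rad2deg_def by measurable
qed

text \<open>
  Clamping at \<open>h\<close> changes nothing at the actual distances, but makes the path gain measurable and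
  positive on the whole line.
\<close>

lemma fading_link_of_PPP:
  fixes M :: "'a measure" and X :: "nat \<Rightarrow> 'a \<Rightarrow> real \<times> real" and g :: "nat \<Rightarrow> 'a \<Rightarrow> real"
  assumes "prob_space M" and lam: "0 < lam" and P: "0 < P_T" and h: "0 < h" and m: "1 \<le> m"
    and PPP: "is_PPP M lam X"
    and dist: "\<And>n. distributed M lborel (g n) (erlang_density (m - 1) (real m))"
    and indep: "prob_space.indep_vars M (\<lambda>_. borel) g UNIV"
    and indep_pos: "prob_space.indep_var M
           (Pi\<^sub>M UNIV (\<lambda>_. borel)) (\<lambda>\<omega> n. X n \<omega>)
           (Pi\<^sub>M UNIV (\<lambda>_. borel)) (\<lambda>\<omega> n. (g n \<omega>, 0::real))"
  shows "fading_link M (dist3 h X) g lam h m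
     (\<lambda>t. P_T * gain h th_t th_3dB A_V (max t h) * max t h powr (- alpha))"
proof -
  interpret prob_space M by fact
  let ?d = "\<lambda>x :: real \<times> real. sqrt ((norm x)\<^sup>2 + h\<^sup>2)"
  have X [measurable]: "X n \<in> borel_measurable M" for n
    using PPP by (simp add: is_PPP_def)
  have pre: "{x. ?d x \<in> B} \<in> sets borel" if "B \<in> sets borel" for B
    using measurable_sets[of ?d borel borel B] that by (simp add: vimage_def)
  have bdd: "bounded {x. ?d x \<in> B}" if B: "bounded B" for B
  proof -
    obtain c where c: "\<And>x. x \<in> B \<Longrightarrow> \<bar>x\<bar> \<le> c" using B by (auto simp: bounded_iff)
    have "norm x \<le> c" if "?d x \<in> B" for x
    proof -
      have "norm x \<le> ?d x" by (intro real_le_rsqrt) auto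
      also have "\<dots> \<le> c" using c[OF that] by auto
      finally show ?thesis .
    qed
    then show ?thesis by (auto simp: bounded_iff)
  qed
  have num: "card {n. dist3 h X n \<omega> \<in> B} = num_in X {x. ?d x \<in> B} \<omega>" for B \<omega>
    by (simp add: num_in_def dist3_def)
  show ?thesis
  proof unfold_locales
    show "dist3 h X n \<in> borel_measurable M" for n
      unfolding dist3_def[abs_def] by measurable
    show "h \<le> dist3 h X n \<omega>" for n \<omega>
      unfolding dist3_def using h by (intro real_le_rsqrt) auto
    show "AE \<omega> in M. finite {n. dist3 h X n \<omega> \<in> B}" if "B \<in> sets borel" "bounded B" for B
    proof -
      have "AE \<omega> in M. finite {n. X n \<omega> \<in> {x. ?d x \<in> B}}"
        using PPP pre[OF that(1)] bdd[OF that(2)] unfolding is_PPP_def by blast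
      then show ?thesis by (simp add: dist3_def)
    qed
    show "measure M {\<omega> \<in> space M. card {n. dist3 h X n \<omega> \<in> B} = k}
        = measure (intensity lam h) B ^ k / fact k * exp (- measure (intensity lam h) B)"
      if "B \<in> sets borel" "bounded B" for B k
      using PPP pre[OF that(1)] bdd[OF that(2)] unfolding num is_PPP_def measure_intensity_eq[OF lam h that(1)] by auto
    show "indep_vars (\<lambda>_. count_space UNIV) (\<lambda>i \<omega>. card {n. dist3 h X n \<omega> \<in> B i}) I"
      if B: "\<And>i. i \<in> I \<Longrightarrow> B i \<in> sets borel \<and> bounded (B i)" and disj: "disjoint_family_on B I" for I :: "nat set" and B
    proof -
      have "disjoint_family_on (\<lambda>i. {x. ?d x \<in> B i}) I"
        using disj by (auto simp: disjoint_family_on_def)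
      then have "indep_vars (\<lambda>_. count_space UNIV) (\<lambda>i. num_in X {x. ?d x \<in> B i}) I"
        using PPP B[THEN conjunct1, THEN pre] B[THEN conjunct2, THEN bdd] unfolding is_PPP_def by simp
      then show ?thesis by (simp add: num)
    qed
    have [measurable]: "(fst :: real \<times> real \<Rightarrow> real) \<in> borel_measurable borel"
      by (intro borel_measurable_continuous_onI continuous_intros)
    have "indep_var (Pi\<^sub>M UNIV (\<lambda>_. borel)) ((\<lambda>x n. ?d (x n)) \<circ> (\<lambda>\<omega> n. X n \<omega>))
        (Pi\<^sub>M UNIV (\<lambda>_. borel)) ((\<lambda>y n. fst (y n)) \<circ> (\<lambda>\<omega> n. (g n \<omega>, 0::real)))"
      by (rule indep_var_compose[OF indep_pos]; rule measurable_PiM_single') measurable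
    then show "indep_var (Pi\<^sub>M UNIV (\<lambda>_. borel)) (\<lambda>\<omega> n. dist3 h X n \<omega>) (Pi\<^sub>M UNIV (\<lambda>_. borel)) (\<lambda>\<omega> n. g n \<omega>)"
      by (simp add: comp_def dist3_def)
    show "(\<lambda>t. P_T * gain h th_t th_3dB A_V (max t h) * max t h powr (- alpha)) \<in> borel_measurable borel"
      using gain_measurable[OF h] by measurable
    show "0 < P_T * gain h th_t th_3dB A_V (max t h) * max t h powr (- alpha)" for t
      using P h gain_pos[of h th_t th_3dB A_V "max t h"] by (simp add: max_def)
  qed (use lam h m dist indep in auto)
qed

theorem theorem1:
  fixes M :: "'a measure"
    and X :: "nat \<Rightarrow> 'a \<Rightarrow> real \<times> real"
    and g :: "nat \<Rightarrow> 'a \<Rightarrow> real"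
    and lam P_T h_d alpha beta th_t th_3dB A_V :: real
    and m :: nat
  assumes "prob_space M"
    and "lam > 0" and "P_T > 0" and "h_d > 0" and "alpha > 0" and "beta > 0"
    and "th_3dB > 0" and "A_V > 0" and "m \<ge> 1"
    and PPP: "is_PPP M lam X"
    and marks_dist: "\<And>n. distributed M lborel (g n) (erlang_density (m - 1) (real m))"
    and marks_indep: "prob_space.indep_vars M (\<lambda>_. borel) g UNIV"
    and indep_pos_marks: "prob_space.indep_var M
           (Pi\<^sub>M UNIV (\<lambda>_. borel)) (\<lambda>\<omega> n. X n \<omega>)
           (Pi\<^sub>M UNIV (\<lambda>_. borel)) (\<lambda>\<omega> n. (g n \<omega>, 0::real))"
  defines "G \<equiv> gain h_d th_t th_3dB A_V"
  shows "(theta1 th_t th_3dB A_V \<ge> 0 \<longrightarrow>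
           coverage_prob M P_T G alpha h_d X g beta =
             (\<Sum>k<m. LINT r:{h_d..}|lborel.
                 cov_term lam P_T m alpha G h_d beta k (AVL A_V) r))
       \<and> (theta1 th_t th_3dB A_V < 0 \<longrightarrow>
           coverage_prob M P_T G alpha h_d X g beta =
             (\<Sum>k<m. LINT r:{h_d..r1 h_d th_t th_3dB A_V}|lborel.
                 cov_term lam P_T m alpha G h_d beta k (AVL A_V) r)
           + (\<Sum>k<m. LINT r:{r1 h_d th_t th_3dB A_V..}|lborel.
                 cov_term lam P_T m alpha G h_d beta k (GammaV h_d th_t th_3dB r) r))"
proof -
  define w where "w t = P_T * G (max t h_d) * max t h_d powr (- alpha)" for t
  interpret fading_link M "dist3 h_d X" g lam h_d m w
    unfolding w_def[abs_def] G_def using assms by (intro fading_link_of_PPP) auto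
  have w: "w t = P_T * G t * t powr (- alpha)" if "h_d \<le> t" for t
    using that by (simp add: w_def max_def)
  let ?u = "cov_integrand beta"
  have u: "cov_term lam P_T m alpha G h_d beta k (G r) r = ?u k r" for k r
    using assms by (intro cov_term_eq_cov_integrand w) (auto simp: G_def gain_pos)
  have u0: "?u k r = 0" if "r < h_d" for k r
    using that by (simp add: cov_integrand_def f_r0_def)
  have rx: "rx_power P_T G alpha h_d X g n \<omega> = w (dist3 h_d X n \<omega>) * g n \<omega>" for n \<omega>
    using D_ge[of n \<omega>] by (simp add: rx_power_def w)
  have cov: "coverage_prob M P_T G alpha h_d X g beta = (\<Sum>k<m. \<integral>r. ?u k r \<partial>lborel)"
    unfolding coverage_eq_sum[OF \<open>beta > 0\<close>, symmetric]
    unfolding coverage_prob_def nearest_def sir_def others_def rx ..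
  let ?r = "r1 h_d th_t th_3dB A_V"
  have "(LINT r:{h_d..}|lborel. cov_term lam P_T m alpha G h_d beta k (AVL A_V) r) = (\<integral>r. ?u k r \<partial>lborel)"
    if "theta1 th_t th_3dB A_V \<ge> 0" for k
  proof -
    have "G r = AVL A_V" for r using that by (simp add: G_def gain_def)
    then have "cov_term lam P_T m alpha G h_d beta k (AVL A_V) r = ?u k r" for r using u[of k r] by simp
    then show ?thesis
      unfolding set_lebesgue_integral_def
      by (intro Bochner_Integration.integral_cong) (auto simp: u0 split: split_indicator)
  qed
  moreover have "(LINT r:{h_d..?r}|lborel. cov_term lam P_T m alpha G h_d beta k (AVL A_V) r)
      + (LINT r:{?r..}|lborel. cov_term lam P_T m alpha G h_d beta k (GammaV h_d th_t th_3dB r) r) = (\<integral>r. ?u k r \<partial>lborel)"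
    if neg: "theta1 th_t th_3dB A_V < 0" and k: "k < m" for k
  proof -
    have int: "integrable lborel (?u k)" using \<open>beta > 0\<close> k by (rule integrable_cov_integrand)
    have G1: "cov_term lam P_T m alpha G h_d beta k (AVL A_V) r = ?u k r" if "r < ?r" for r
      using u[of k r] that neg by (simp add: G_def gain_def)
    have G2: "cov_term lam P_T m alpha G h_d beta k (GammaV h_d th_t th_3dB r) r = ?u k r" if "?r \<le> r" for r
      using u[of k r] that neg by (simp add: G_def gain_def)
    have intA: "integrable lborel (\<lambda>r. indicator A r * ?u k r)" if "A \<in> sets borel" for A
      using integrable_real_mult_indicator[OF _ int, of A] that by (simp add: mult.commute)
    define c where "c = indicator {h_d..?r} ?r * cov_term lam P_T m alpha G h_d beta k (AVL A_V) ?r"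
    have "(LINT r:{h_d..?r}|lborel. cov_term lam P_T m alpha G h_d beta k (AVL A_V) r)
        = (\<integral>r. indicator {..<?r} r * ?u k r + c * indicator {?r} r \<partial>lborel)"
      unfolding set_lebesgue_integral_def
      by (intro Bochner_Integration.integral_cong) (auto simp: c_def G1 u0 split: split_indicator)
    also have "\<dots> = (\<integral>r. indicator {..<?r} r * ?u k r \<partial>lborel)"
      by (subst Bochner_Integration.integral_add) (auto intro!: intA)
    finally have L: "(LINT r:{h_d..?r}|lborel. cov_term lam P_T m alpha G h_d beta k (AVL A_V) r)
        = (\<integral>r. indicator {..<?r} r * ?u k r \<partial>lborel)" .
    have R: "(LINT r:{?r..}|lborel. cov_term lam P_T m alpha G h_d beta k (GammaV h_d th_t th_3dB r) r)
        = (\<integral>r. indicator {?r..} r * ?u k r \<partial>lborel)"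
      unfolding set_lebesgue_integral_def
      by (intro Bochner_Integration.integral_cong) (auto simp: G2 split: split_indicator)
    have "(\<integral>r. indicator {..<?r} r * ?u k r \<partial>lborel) + (\<integral>r. indicator {?r..} r * ?u k r \<partial>lborel)
        = (\<integral>r. indicator {..<?r} r * ?u k r + indicator {?r..} r * ?u k r \<partial>lborel)"
      by (intro Bochner_Integration.integral_add[symmetric] intA) auto
    also have "\<dots> = (\<integral>r. ?u k r \<partial>lborel)"
      by (intro Bochner_Integration.integral_cong) (auto split: split_indicator)
    finally show ?thesis unfolding L R .
  qed
  ultimately show ?thesis
    by (simp add: cov sum.distrib[symmetric])
qed

end
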